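(* For $\theta\in[0,1]$, consider the following numerical method for the delay initial value problem $y'(t)=f(t,y(t),y(t-\tau))$, $t\in[0,T]$, $y(t)=\phi(t)$ for $-\tau\le t\le 0$, on the grid $t_n=nh$: $y_0=\phi(0)$ and, for $n=0,1,\dots,N-1$, $$k_1=f(t_n,y_n,\nu_n),\quad k_2=f(t_{n+1},\,y_n+h(1-\theta)k_1,\,\nu_{n+1}),\quad k_3=f(t_{n+1},\,y_n+h(1-\theta)k_1+h\theta k_2,\,\nu_{n+1}),$$ $$y_{n+1}=y_n+h(1-\theta)k_1+h\theta k_3,$$ where $\nu_n$ is the approximation of the delay term $y(t_n-\tau)$ given in the context. This family of methods forms a second order numerical method for $\theta=\tfrac12$, and has first order convergence for any other value of $\theta\in[0,1]$.
   Context: Setting: $d\ge 1$ is an integer, $\tau>0$ is a constant delay, $T>0$, $\phi:[-\tau,0]\to\mathbb{R}^d$ is the history function, and $f:[0,T]\times\mathbb{R}^d\times\mathbb{R}^d\to\mathbb{R}^d$ is non-linear, bounded and continuous, and satisfies the Lipschitz conditions $$|f(t,x_1,u)-f(t,x_2,u)|\le L_1|x_1-x_2|,\qquad |f(t,x,u_1)-f(t,x,u_2)|\le L_2|u_1-u_2|$$ with positive constants $L_1,L_2$ (assumed for existence and uniqueness of the solution $y$). Grid: the grid is uniform with step size $h>0$, $t_n=nh$ for $n=-m,-m+1,\dots,N$, where $m=\tau/h$ and $N=T/h$ are integers. $y_n$ denotes the computed approximation of $y(t_n)$. Delay approximation: $\nu_n=y_{n-m}$ if $n\ge m$, and $\nu_n=\phi(t_n-\tau)$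 if $n<m$. "Second order" and "first order convergence" refer to the order of the numerical method in the step size $h$, in the usual sense of numerical analysis of differential equations. *)

theory Defs
  imports "HOL-Analysis.Analysis"
begin

text \<open>Delay initial value problems  y'(t) = f(t, y(t), y(t - \<tau>)) on [0,T] with history
  \<phi> on [-\<tau>,0].  The values of f and \<phi> outside these domains are irrelevant.\<close>

type_synonym 'v dde_rhs = "real \<Rightarrow> 'v \<Rightarrow> 'v \<Rightarrow> 'v"

definition dde_domain :: "real \<Rightarrow> (real \<times> 'v \<times> 'v) set" where
  "dde_domain T = {0..T} \<times> UNIV \<times> UNIV"

text \<open>Derivatives are taken within S, hence one-sided at the boundary. They are unique on
  the sets used below (non-degenerate intervals, possibly times a full space). In finite
  dimension, continuity of all directional derivatives f' x v in x is continuity of f' in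
  operator norm, so this is the usual class C^k.\<close>

primrec Ck_on :: "nat \<Rightarrow> 'a::real_normed_vector set \<Rightarrow> ('a \<Rightarrow> 'b::real_normed_vector) \<Rightarrow> bool"
  where
    "Ck_on 0 S f = continuous_on S f"
  | "Ck_on (Suc k) S f =
      (\<exists>f'. (\<forall>x\<in>S. (f has_derivative f' x) (at x within S)) \<and> (\<forall>v. Ck_on k S (\<lambda>x. f' x v)))"

text \<open>The equation is linear if it reads  y' = A(t) y(t) + B(t) y(t - \<tau>) + c(t).\<close>

definition nonlinear_rhs :: "real \<Rightarrow> 'v::real_vector dde_rhs \<Rightarrow> bool" where
  "nonlinear_rhs T f \<longleftrightarrow>
    \<not> (\<exists>A B c. \<forall>t\<in>{0..T}. linear (A t) \<and> linear (B t) \<and> (\<forall>x u. f t x u = A t x + B t u + c t))"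

definition admissible_rhs :: "real \<Rightarrow> 'v::real_normed_vector dde_rhs \<Rightarrow> bool" where
  "admissible_rhs T f \<longleftrightarrow>
    nonlinear_rhs T f \<and>
    bounded ((\<lambda>(t, x, u). f t x u) ` dde_domain T) \<and>
    continuous_on (dde_domain T) (\<lambda>(t, x, u). f t x u) \<and>
    (\<exists>L1>0. \<forall>t\<in>{0..T}. \<forall>x1 x2 u. norm (f t x1 u - f t x2 u) \<le> L1 * norm (x1 - x2)) \<and>
    (\<exists>L2>0. \<forall>t\<in>{0..T}. \<forall>x u1 u2. norm (f t x u1 - f t x u2) \<le> L2 * norm (u1 - u2))"

definition dde_solution ::
  "real \<Rightarrow> real \<Rightarrow> 'v::real_normed_vector dde_rhs \<Rightarrow> (real \<Rightarrow> 'v) \<Rightarrow> (real \<Rightarrow> 'v) \<Rightarrow> bool" where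
  "dde_solution \<tau> T f \<phi> y \<longleftrightarrow>
    (\<forall>t\<in>{-\<tau>..0}. y t = \<phi> t) \<and>
    (\<forall>t\<in>{0..T}. (y has_vector_derivative f t (y t) (y (t - \<tau>))) (at t within {0..T}))"

definition uniform_grid :: "real \<Rightarrow> real \<Rightarrow> real \<Rightarrow> nat \<Rightarrow> nat \<Rightarrow> bool" where
  "uniform_grid \<tau> T h m N \<longleftrightarrow> 0 < h \<and> \<tau> = real m * h \<and> T = real N * h"

text \<open>A method relates f, \<phi>, h, m, N to the computed sequence of approximations, of which only
  the members with index at most N matter.\<close>

type_synonym 'v dde_method =
  "'v dde_rhs \<Rightarrow> (real \<Rightarrow> 'v) \<Rightarrow> real \<Rightarrow> nat \<Rightarrow> nat \<Rightarrow> (nat \<Rightarrow> 'v) \<Rightarrow> bool"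

definition delay_approx ::
  "real \<Rightarrow> (real \<Rightarrow> 'v) \<Rightarrow> real \<Rightarrow> nat \<Rightarrow> (nat \<Rightarrow> 'v) \<Rightarrow> nat \<Rightarrow> 'v" where
  "delay_approx \<tau> \<phi> h m Y n = (if n \<ge> m then Y (n - m) else \<phi> (real n * h - \<tau>))"

definition theta_step :: "real \<Rightarrow> 'v::real_vector dde_rhs \<Rightarrow> real \<Rightarrow> (nat \<Rightarrow> 'v) \<Rightarrow> nat \<Rightarrow> 'v \<Rightarrow> 'v" where
  "theta_step \<theta> f h \<nu> n x =
    (let k1 = f (real n * h) x (\<nu> n);
         k2 = f (real (n + 1) * h) (x + (h * (1 - \<theta>)) *\<^sub>R k1) (\<nu> (n + 1));
         k3 = f (real (n + 1) * h) (x + (h * (1 - \<theta>)) *\<^sub>R k1 + (h * \<theta>) *\<^sub>R k2) (\<nu> (n + 1))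
     in x + (h * (1 - \<theta>)) *\<^sub>R k1 + (h * \<theta>) *\<^sub>R k3)"

text \<open>Since \<tau> > 0 forces m > 0, the value \<nu> (n + 1) only involves members of Y with index at
  most n, so that the recursion is explicit.\<close>

definition theta_method :: "real \<Rightarrow> real \<Rightarrow> 'v::real_vector dde_method" where
  "theta_method \<tau> \<theta> f \<phi> h m N Y \<longleftrightarrow>
    Y 0 = \<phi> 0 \<and>
    (\<forall>n<N. Y (n + 1) = theta_step \<theta> f h (delay_approx \<tau> \<phi> h m Y) n (Y n))"

text \<open>Order of convergence at least p: the global error is O(h^p) as h tends to 0, uniformly
  over the grid, for all sufficiently smooth data. The bound C may depend on the problem but
  not on h. As usual for orders of methods, smoothness of the data is implied; here f and
  \<phi> are of class C^p. No smoothness is required of the solution, whose derivatives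
  generally jump at multiples of \<tau>.\<close>

definition convergence_order_ge ::
  "real \<Rightarrow> real \<Rightarrow> 'v::real_normed_vector dde_method \<Rightarrow> nat \<Rightarrow> bool" where
  "convergence_order_ge \<tau> T method p \<longleftrightarrow>
    (\<forall>f \<phi> y.
      admissible_rhs T f \<and> Ck_on p (dde_domain T) (\<lambda>(t, x, u). f t x u) \<and>
      Ck_on p {-\<tau>..0} \<phi> \<and> dde_solution \<tau> T f \<phi> y \<longrightarrow>
      (\<exists>C>0. \<exists>h0>0. \<forall>h m N Y.
        uniform_grid \<tau> T h m N \<and> h \<le> h0 \<and> method f \<phi> h m N Y \<longrightarrow>
        (\<forall>n\<le>N. norm (Y n - y (real n * h)) \<le> C * h ^ p)))"

text \<open>The order is the best possible exponent for smooth data.\<close>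

definition has_convergence_order ::
  "real \<Rightarrow> real \<Rightarrow> 'v::real_normed_vector dde_method \<Rightarrow> nat \<Rightarrow> bool" where
  "has_convergence_order \<tau> T method p \<longleftrightarrow>
    convergence_order_ge \<tau> T method p \<and> \<not> convergence_order_ge \<tau> T method (p + 1)"

end

theory Submission
  imports Defs
begin

text \<open>Convergence: the right-hand side y' of the equation is Lipschitz along the solution, and for
  data of class C^2 the derivative of y' is Lipschitz on each of [0,\<tau>] and [\<tau>,T].  Since \<tau> is a
  multiple of h, no grid cell straddles the point \<tau>, so the quadrature rule with weights 1 - \<theta> and \<theta>
  is accurate to O(h^2) per step, and to O(h^3) for \<theta> = 1/2.  Replacing y' at the right end point by
  the predicted value k3 costs only a further O(h^3), and a discrete Gronwall argument over the whole
  past of the approximation gives the global error.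

  Optimality: if f depends on t alone, the method is exactly this quadrature rule, whose global error for
  y = t^2 (\<theta> \<noteq> 1/2) or y = t^3 (\<theta> = 1/2) is a non-zero multiple of T h^p.  A perturbation of f that
  vanishes for u \<ge> 0 makes f non-linear without affecting these non-negative solutions.\<close>

section \<open>Class C^k, Lipschitz functions and the trapezoidal rule\<close>

lemma Ck_on_imp_continuous_on:
  "Ck_on k S f \<Longrightarrow> continuous_on S f"
  by (cases k) (auto simp: continuous_on_eq_continuous_within intro: has_derivative_continuous)

lemma Ck_on_SucD: "Ck_on (Suc k) S f \<Longrightarrow> Ck_on k S f"
proof (induction k arbitrary: f)
  case 0
  then show ?case using Ck_on_imp_continuous_on[of "Suc 0" S f] by simp
next
  case (Suc k)
  then show ?case by (metis Ck_on.simps(2))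
qed

text \<open>Only derivatives in fixed directions are known to be continuous. They are bounded on
  \<open>K\<close> for each basis vector, and linearity of \<open>f' x\<close> turns finitely many
  such bounds into one operator norm bound \<open>L\<close>; the mean value inequality on the convex
  set \<open>K\<close> then applies.\<close>

lemma Ck_on_1_imp_lipschitz_on_compact:
  fixes f :: "'a::euclidean_space \<Rightarrow> 'b::real_normed_vector"
  assumes "Ck_on (Suc 0) S f" "compact K" "convex K" "K \<subseteq> S"
  shows "\<exists>L. L-lipschitz_on K f"
proof -
  from assms(1) obtain f' where f': "\<And>x. x \<in> S \<Longrightarrow> (f has_derivative f' x) (at x within S)"
    and cont: "\<And>v. continuous_on S (\<lambda>x. f' x v)"
    by auto
  have "\<exists>B. \<forall>x\<in>K. norm (f' x b) \<le> B" for b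
    using compact_imp_bounded[OF compact_continuous_image[OF continuous_on_subset[OF cont assms(4)] assms(2)]]
    unfolding bounded_iff by blast
  then obtain B where B: "\<And>x b. x \<in> K \<Longrightarrow> norm (f' x b) \<le> B b"
    by metis
  define L where "L = (\<Sum>b\<in>Basis. \<bar>B b\<bar>)"
  have L0: "L \<ge> 0"
    unfolding L_def by (simp add: sum_nonneg)
  have on: "onorm (f' x) \<le> L" if "x \<in> K" for x
  proof (rule onorm_bound[OF L0])
    fix v
    have lin: "linear (f' x)"
      using f' that assms(4) has_derivative_linear by blast
    have "norm (f' x v) = norm (f' x (\<Sum>b\<in>Basis. (v \<bullet> b) *\<^sub>R b))"
      by (simp add: euclidean_representation)
    also have "\<dots> = norm (\<Sum>b\<in>Basis. (v \<bullet> b) *\<^sub>R f' x b)"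
      by (simp add: linear_sum[OF lin] linear_scale[OF lin])
    also have "\<dots> \<le> (\<Sum>b\<in>Basis. norm ((v \<bullet> b) *\<^sub>R f' x b))"
      by (rule norm_sum)
    also have "\<dots> \<le> (\<Sum>b\<in>Basis. norm v * \<bar>B b\<bar>)"
    proof (rule sum_mono)
      fix b :: 'a assume "b \<in> Basis"
      then show "norm ((v \<bullet> b) *\<^sub>R f' x b) \<le> norm v * \<bar>B b\<bar>"
        using B[OF that, of b] Basis_le_norm[of b v] by (auto intro!: mult_mono)
    qed
    also have "\<dots> = L * norm v"
      by (simp add: L_def sum_distrib_left mult.commute)
    finally show "norm (f' x v) \<le> L * norm v" .
  qed
  have "L-lipschitz_on K f"
  proof (rule lipschitz_onI[OF _ L0])
    fix x y assume "x \<in> K" "y \<in> K"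
    then show "dist (f x) (f y) \<le> L * dist x y"
      unfolding dist_norm
      using differentiable_bound[OF assms(3) has_derivative_subset[OF f' assms(4)] on] assms(4)
      by blast
  qed
  then show ?thesis by blast
qed

lemma lipschitz_on_has_vector_derivative_bound:
  fixes y :: "real \<Rightarrow> 'b::real_normed_vector"
  assumes "convex S" "0 \<le> B"
    and "\<And>t. t \<in> S \<Longrightarrow> (y has_vector_derivative g t) (at t within S)"
    and "\<And>t. t \<in> S \<Longrightarrow> norm (g t) \<le> B"
  shows "B-lipschitz_on S y"
proof (rule lipschitz_onI[OF _ assms(2)])
  fix s t assume "s \<in> S" "t \<in> S"
  then show "dist (y s) (y t) \<le> B * dist s t"
    unfolding dist_norm
  proof (intro differentiable_bound[OF assms(1)])
    fix t assume t: "t \<in> S"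
    show "(y has_derivative (\<lambda>h. h *\<^sub>R g t)) (at t within S)"
      using assms(3)[OF t] by (simp add: has_vector_derivative_def)
    show "onorm (\<lambda>h. h *\<^sub>R g t) \<le> B"
      using assms(4)[OF t]
      by (intro onorm_bound[OF assms(2)]) (auto simp: mult.commute[of B] intro!: mult_left_mono)
  qed
qed

section \<open>Products and sums of Lipschitz functions\<close>

lemma lipschitz_on_scaleR_compact:
  fixes c :: "'a::metric_space \<Rightarrow> real" and F :: "'a \<Rightarrow> 'b::real_normed_vector"
  assumes "compact I" "\<exists>L. L-lipschitz_on I c" "\<exists>L. L-lipschitz_on I F"
  shows "\<exists>L. L-lipschitz_on I (\<lambda>t. c t *\<^sub>R F t)"
proof -
  obtain Lc LF where Lc: "Lc-lipschitz_on I c" and LF: "LF-lipschitz_on I F"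
    using assms by blast
  have "bounded (c ` I)" "bounded (F ` I)"
    using assms(1) Lc LF
    by (auto intro!: compact_imp_bounded compact_continuous_image lipschitz_on_continuous_on)
  then obtain Bc BF where B: "\<And>t. t \<in> I \<Longrightarrow> \<bar>c t\<bar> \<le> Bc" "\<And>t. t \<in> I \<Longrightarrow> norm (F t) \<le> BF"
    by (auto simp: bounded_iff)
  have nn: "Lc \<ge> 0" "LF \<ge> 0"
    using Lc LF lipschitz_on_nonneg by auto
  have "(\<bar>Bc\<bar> * LF + Lc * \<bar>BF\<bar>)-lipschitz_on I (\<lambda>t. c t *\<^sub>R F t)"
  proof (rule lipschitz_onI)
    fix s t assume st: "s \<in> I" "t \<in> I"
    have "c s *\<^sub>R F s - c t *\<^sub>R F t = c s *\<^sub>R (F s - F t) + (c s - c t) *\<^sub>R F t"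
      by (simp add: algebra_simps)
    then have "norm (c s *\<^sub>R F s - c t *\<^sub>R F t) \<le> \<bar>c s\<bar> * norm (F s - F t) + \<bar>c s - c t\<bar> * norm (F t)"
      using norm_triangle_ineq[of "c s *\<^sub>R (F s - F t)" "(c s - c t) *\<^sub>R F t"] by simp
    also have "\<dots> \<le> \<bar>Bc\<bar> * (LF * dist s t) + (Lc * dist s t) * \<bar>BF\<bar>"
      using B(1)[OF st(1)] B(2)[OF st(2)] lipschitz_onD[OF Lc st] lipschitz_onD[OF LF st] nn
      by (intro add_mono mult_mono) (auto simp: dist_norm)
    finally show "dist (c s *\<^sub>R F s) (c t *\<^sub>R F t) \<le> (\<bar>Bc\<bar> * LF + Lc * \<bar>BF\<bar>) * dist s t"
      by (simp add: dist_norm algebra_simps)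
  qed (use nn in auto)
  then show ?thesis by blast
qed

lemma lipschitz_on_sum:
  fixes F :: "'i \<Rightarrow> 'a::metric_space \<Rightarrow> 'b::real_normed_vector"
  assumes "\<And>i. i \<in> J \<Longrightarrow> \<exists>L. L-lipschitz_on I (F i)"
  shows "\<exists>L. L-lipschitz_on I (\<lambda>t. \<Sum>i\<in>J. F i t)"
  using assms
proof (induction J rule: infinite_finite_induct)
  case (insert j J)
  then obtain L1 L2 where "L1-lipschitz_on I (F j)" "L2-lipschitz_on I (\<lambda>t. \<Sum>i\<in>J. F i t)"
    by blast
  then have "(L1 + L2)-lipschitz_on I (\<lambda>t. F j t + (\<Sum>i\<in>J. F i t))"
    by (rule lipschitz_on_add)
  then show ?case using insert by auto
qed (auto intro: lipschitz_on_constant)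

text \<open>Taylor expansion at \<open>a\<close>, with the mean value inequality in place of an
  integral remainder. A Lipschitz \<open>g'\<close> stands in for a second derivative of
  \<open>g\<close>, which matters because higher derivatives of the solution may jump.\<close>

lemma trapezoid_error:
  fixes y :: "real \<Rightarrow> 'b::real_normed_vector"
  assumes ab: "a \<le> b"
    and y: "\<And>t. t \<in> {a..b} \<Longrightarrow> (y has_vector_derivative g t) (at t within {a..b})"
    and g: "\<And>t. t \<in> {a..b} \<Longrightarrow> (g has_vector_derivative g' t) (at t within {a..b})"
    and L: "L-lipschitz_on {a..b} g'"
  shows "norm (y b - y a - ((b - a) / 2) *\<^sub>R (g a + g b)) \<le> 2 * L * (b - a) ^ 3"
proof -
  have L0: "L \<ge> 0" using L lipschitz_on_nonneg by auto
  \<comment> \<open>The remainder of the first-order expansion of \<open>g\<close> has derivative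
    \<open>g' s - g' a\<close>, which the Lipschitz bound controls.\<close>
  have g_err: "norm (g t - g a - (t - a) *\<^sub>R g' a) \<le> L * (b - a) ^ 2" if t: "t \<in> {a..b}" for t
  proof -
    have "(L * (b - a))-lipschitz_on {a..b} (\<lambda>t. g t - (t - a) *\<^sub>R g' a)"
    proof (rule lipschitz_on_has_vector_derivative_bound[where g = "\<lambda>t. g' t - g' a"])
      fix s assume s: "s \<in> {a..b}"
      show "((\<lambda>t. g t - (t - a) *\<^sub>R g' a) has_vector_derivative g' s - g' a) (at s within {a..b})"
        by (rule derivative_eq_intros g[OF s] refl | simp)+
      have "norm (g' s - g' a) \<le> L * (s - a)"
        using lipschitz_onD[OF L s, of a] s by (simp add: dist_norm)
      also have "\<dots> \<le> L * (b - a)" using s L0 by (auto intro!: mult_left_mono)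
      finally show "norm (g' s - g' a) \<le> L * (b - a)" .
    qed (use ab L0 in auto)
    from lipschitz_onD[OF this t, of a]
    have "norm (g t - g a - (t - a) *\<^sub>R g' a) \<le> L * (b - a) * (t - a)"
      using t by (simp add: dist_norm algebra_simps)
    also have "\<dots> \<le> L * (b - a) * (b - a)" using t L0 by (auto intro!: mult_left_mono)
    finally show ?thesis by (simp add: power2_eq_square)
  qed
  have "(L * (b - a)^2)-lipschitz_on {a..b} (\<lambda>t. y t - (t - a) *\<^sub>R g a - ((t - a)^2 / 2) *\<^sub>R g' a)"
  proof (rule lipschitz_on_has_vector_derivative_bound[where g = "\<lambda>t. g t - g a - (t - a) *\<^sub>R g' a"])
    fix s assume s: "s \<in> {a..b}"
    have q: "((\<lambda>t. (t - a)^2 / 2) has_real_derivative (s - a)) (at s within {a..b})"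
      by (rule derivative_eq_intros refl | simp)+
    show "((\<lambda>t. y t - (t - a) *\<^sub>R g a - ((t - a)^2 / 2) *\<^sub>R g' a)
      has_vector_derivative g s - g a - (s - a) *\<^sub>R g' a) (at s within {a..b})"
      by (rule derivative_eq_intros y[OF s] q refl | simp)+
  qed (use ab L0 g_err in auto)
  from lipschitz_onD[OF this, of b a]
  have y_err: "norm (y b - y a - (b - a) *\<^sub>R g a - ((b - a)^2 / 2) *\<^sub>R g' a) \<le> L * (b - a)^2 * (b - a)"
    using ab by (simp add: dist_norm algebra_simps)
  \<comment> \<open>Inserting the expansion of \<open>g b\<close> cancels the quadratic term and
    leaves two remainders of third order.\<close>
  have "y b - y a - ((b - a) / 2) *\<^sub>R (g a + g b)
    = (y b - y a - (b - a) *\<^sub>R g a - ((b - a)^2 / 2) *\<^sub>R g' a)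
      - ((b - a) / 2) *\<^sub>R (g b - g a - (b - a) *\<^sub>R g' a)"
  proof -
    have "(b - a) *\<^sub>R g a = ((b - a) / 2) *\<^sub>R g a + ((b - a) / 2) *\<^sub>R g a"
      by (simp flip: scaleR_left.add)
    then show ?thesis
      by (simp add: scaleR_add_right scaleR_diff_right power2_eq_square)
  qed
  also have "norm \<dots> \<le> L * (b - a)^2 * (b - a) + ((b - a) / 2) * (L * (b - a)^2)"
    using mult_left_mono[OF g_err[of b], of "(b - a) / 2"] ab
    by (intro order.trans[OF norm_triangle_ineq4] add_mono y_err) simp
  also have "\<dots> \<le> 2 * L * (b - a) ^ 3"
    using L0 ab by (simp add: power2_eq_square power3_eq_cube)
  finally show ?thesis .
qed

section \<open>Stability and consistency of one step\<close>

text \<open>One bound \<open>E\<close> serves for the current value and both delayed values, since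
  delayed values are earlier members of the sequence or history. Three nested uses of the Lipschitz
  condition give \<open>2 * L * (1 + L)\<^sup>2\<close>; a factor \<open>h\<close> must survive in
  front so that the amplification over T / h steps stays bounded.\<close>

lemma theta_step_stable:
  fixes f :: "'v::real_normed_vector dde_rhs"
  assumes lip: "\<And>t x1 x2 u1 u2. t \<in> {real n * h, real (n + 1) * h} \<Longrightarrow>
      norm (f t x1 u1 - f t x2 u2) \<le> L * norm (x1 - x2) + L * norm (u1 - u2)"
    and L: "0 \<le> L" and \<theta>: "0 \<le> \<theta>" "\<theta> \<le> 1" and h: "0 \<le> h" "h \<le> 1"
    and E: "norm (x - x') \<le> E" "norm (\<nu> n - \<nu>' n) \<le> E" "norm (\<nu> (n + 1) - \<nu>' (n + 1)) \<le> E"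
  shows "norm (theta_step \<theta> f h \<nu> n x - theta_step \<theta> f h \<nu>' n x') \<le> (1 + h * (2 * L * (1 + L)\<^sup>2)) * E"
proof -
  define k1 where "k1 \<nu> x = f (real n * h) x (\<nu> n)" for \<nu> :: "nat \<Rightarrow> 'v" and x
  define a where "a \<nu> x = x + (h * (1 - \<theta>)) *\<^sub>R k1 \<nu> x" for \<nu> x
  define k2 where "k2 \<nu> x = f (real (n + 1) * h) (a \<nu> x) (\<nu> (n + 1))" for \<nu> x
  define b where "b \<nu> x = a \<nu> x + (h * \<theta>) *\<^sub>R k2 \<nu> x" for \<nu> x
  define k3 where "k3 \<nu> x = f (real (n + 1) * h) (b \<nu> x) (\<nu> (n + 1))" for \<nu> x
  have step: "theta_step \<theta> f h \<nu> n x = a \<nu> x + (h * \<theta>) *\<^sub>R k3 \<nu> x" for \<nu> x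
    by (simp add: theta_step_def Let_def a_def k1_def k2_def k3_def b_def)
  have E0: "0 \<le> E" using E(1) norm_ge_zero order.trans by blast
  have h\<theta>: "0 \<le> h * \<theta>" "h * \<theta> \<le> 1" "0 \<le> h * (1 - \<theta>)" "h * (1 - \<theta>) \<le> 1"
    using \<theta> h by (auto simp: mult_le_one)
  have lipE: "norm (f t x1 u1 - f t x2 u2) \<le> L * A + L * E"
    if "t \<in> {real n * h, real (n + 1) * h}" "norm (x1 - x2) \<le> A" "norm (u1 - u2) \<le> E"
    for t x1 x2 u1 u2 A
    using lip[OF that(1), of x1 u1 x2 u2] mult_left_mono[OF that(2) L] mult_left_mono[OF that(3) L]
    by linarith
  have perturb: "norm (u + c *\<^sub>R k - (u' + c *\<^sub>R k')) \<le> A + c * B"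
    if "norm (u - u') \<le> A" "norm (k - k') \<le> B" "0 \<le> c" for u u' k k' :: 'v and c A B
  proof -
    have "u + c *\<^sub>R k - (u' + c *\<^sub>R k') = (u - u') + c *\<^sub>R (k - k')"
      by (simp add: algebra_simps)
    also have "norm \<dots> \<le> A + c * B"
      using that mult_left_mono[OF that(2,3)] by (intro norm_triangle_mono) auto
    finally show ?thesis .
  qed
  have k1: "norm (k1 \<nu> x - k1 \<nu>' x') \<le> L * E + L * E"
    unfolding k1_def by (rule lipE) (use E in auto)
  have a: "norm (a \<nu> x - a \<nu>' x') \<le> E + h * (1 - \<theta>) * (L * E + L * E)"
    unfolding a_def by (rule perturb[OF E(1) k1 h\<theta>(3)])
  \<comment> \<open>Inside the later stages the weight is replaced by 1; the sharp bound
    \<open>a\<close> is kept for the final sum, where its factor \<open>h\<close> is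
    required.\<close>
  also have "\<dots> \<le> E + 1 * (L * E + L * E)"
    using h\<theta> E0 L by (intro add_left_mono mult_right_mono) auto
  finally have a': "norm (a \<nu> x - a \<nu>' x') \<le> E + 1 * (L * E + L * E)" .
  have k2: "norm (k2 \<nu> x - k2 \<nu>' x') \<le> L * (E + 1 * (L * E + L * E)) + L * E"
    unfolding k2_def by (rule lipE) (use E a' in auto)
  have "norm (b \<nu> x - b \<nu>' x')
      \<le> (E + 1 * (L * E + L * E)) + h * \<theta> * (L * (E + 1 * (L * E + L * E)) + L * E)"
    unfolding b_def by (rule perturb[OF a' k2 h\<theta>(1)])
  also have "\<dots> \<le> (E + 1 * (L * E + L * E)) + 1 * (L * (E + 1 * (L * E + L * E)) + L * E)"
    using h\<theta> E0 L by (intro add_left_mono mult_right_mono) auto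
  finally have b: "norm (b \<nu> x - b \<nu>' x')
      \<le> (E + 1 * (L * E + L * E)) + 1 * (L * (E + 1 * (L * E + L * E)) + L * E)" .
  have "norm (k3 \<nu> x - k3 \<nu>' x')
      \<le> L * ((E + 1 * (L * E + L * E)) + 1 * (L * (E + 1 * (L * E + L * E)) + L * E)) + L * E"
    unfolding k3_def by (rule lipE) (use E b in auto)
  also have "\<dots> = 2 * L * (1 + L)\<^sup>2 * E"
    by (simp add: power2_eq_square algebra_simps)
  finally have k3: "norm (k3 \<nu> x - k3 \<nu>' x') \<le> 2 * L * (1 + L)\<^sup>2 * E" .
  have "norm (theta_step \<theta> f h \<nu> n x - theta_step \<theta> f h \<nu>' n x')
      \<le> (E + h * (1 - \<theta>) * (L * E + L * E)) + h * \<theta> * (2 * L * (1 + L)\<^sup>2 * E)"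
    unfolding step by (rule perturb[OF a k3 h\<theta>(1)])
  \<comment> \<open>Enlarging the bound for \<open>k1\<close> to that for \<open>k3\<close> lets the
    weights 1 - \<theta> and \<theta> add up to 1.\<close>
  also have "\<dots> \<le> (E + h * (1 - \<theta>) * (2 * L * (1 + L)\<^sup>2 * E)) + h * \<theta> * (2 * L * (1 + L)\<^sup>2 * E)"
  proof -
    have "L * E * 1 \<le> L * E * (1 + L)\<^sup>2"
      using L E0 by (intro mult_left_mono) auto
    then have "L * E + L * E \<le> 2 * L * (1 + L)\<^sup>2 * E" by (simp add: ac_simps)
    then show ?thesis using h\<theta> by (intro add_right_mono add_left_mono mult_left_mono) auto
  qed
  also have "\<dots> = (1 + h * (2 * L * (1 + L)\<^sup>2)) * E"
    by (simp add: algebra_simps)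
  finally show ?thesis .
qed

text \<open>With the exact slope \<open>g1\<close> at the right end point only the quadrature error
  would remain. The method uses \<open>k3\<close> instead, and each evaluation of \<open>f\<close>
  at a predicted value multiplies the previous error by \<open>h * L\<close>, so two evaluations
  reduce a crude error of size \<open>h * M\<close> to order \<open>h ^ 3\<close>.\<close>

lemma theta_step_consistent:
  fixes f :: "'v::real_normed_vector dde_rhs"
  assumes lip: "\<And>x1 x2 u. norm (f (real (n + 1) * h) x1 u - f (real (n + 1) * h) x2 u) \<le> L * norm (x1 - x2)"
    and bd: "\<And>x u. norm (f (real (n + 1) * h) x u) \<le> M"
    and nonneg: "0 \<le> L" "0 \<le> M" "0 \<le> Q" and \<theta>: "0 \<le> \<theta>" "\<theta> \<le> 1" and h: "0 \<le> h" "h \<le> 1"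
    and p: "p \<le> 2"
    and quad: "norm (y1 - y0 - (h * (1 - \<theta>)) *\<^sub>R f (real n * h) y0 (\<nu> n)
        - (h * \<theta>) *\<^sub>R f (real (n + 1) * h) y1 (\<nu> (n + 1))) \<le> Q * h ^ (p + 1)"
  shows "norm (theta_step \<theta> f h \<nu> n y0 - y1) \<le> (Q + L * Q + L\<^sup>2 * Q + L\<^sup>2 * M) * h ^ (p + 1)"
proof -
  define g1 where "g1 = f (real (n + 1) * h) y1 (\<nu> (n + 1))"
  define a where "a = y0 + (h * (1 - \<theta>)) *\<^sub>R f (real n * h) y0 (\<nu> n)"
  define k2 where "k2 = f (real (n + 1) * h) a (\<nu> (n + 1))"
  define k3 where "k3 = f (real (n + 1) * h) (a + (h * \<theta>) *\<^sub>R k2) (\<nu> (n + 1))"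
  define q where "q = Q * h ^ (p + 1)"
  have q0: "0 \<le> q" using nonneg h by (simp add: q_def)
  have step: "theta_step \<theta> f h \<nu> n y0 = a + (h * \<theta>) *\<^sub>R k3"
    by (simp add: theta_step_def Let_def a_def k2_def k3_def)
  have res: "norm (a + (h * \<theta>) *\<^sub>R g1 - y1) \<le> q"
    using quad by (subst norm_minus_commute) (simp add: a_def g1_def q_def algebra_simps)
  \<comment> \<open>An error \<open>B\<close> in the slope used at the right end point costs at most
    \<open>h * B\<close>, since \<theta> \<le> 1.\<close>
  have perturb: "norm (a + (h * \<theta>) *\<^sub>R k - y1) \<le> q + h * B" if "norm (k - g1) \<le> B" for k B
  proof -
    have "0 \<le> B" using that norm_ge_zero order.trans by blast
    have "a + (h * \<theta>) *\<^sub>R k - y1 = (a + (h * \<theta>) *\<^sub>R g1 - y1) + (h * \<theta>) *\<^sub>R (k - g1)"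
      by (simp add: algebra_simps)
    also have "norm \<dots> \<le> q + h * \<theta> * norm (k - g1)"
      using res h \<theta> by (intro norm_triangle_mono) auto
    also have "h * \<theta> * norm (k - g1) \<le> (h * 1) * B"
      using that h \<theta> \<open>0 \<le> B\<close> by (intro mult_mono) auto
    finally show ?thesis by (simp add: add_left_mono)
  qed
  have "norm (k2 - g1) \<le> L * norm (a - y1)"
    unfolding k2_def g1_def by (rule lip)
  \<comment> \<open>The value \<open>a\<close> is the case of slope 0, whose distance to
    \<open>g1\<close> is at most \<open>M\<close>.\<close>
  also have "\<dots> \<le> L * (q + h * M)"
    using perturb[of 0 M] bd nonneg by (intro mult_left_mono) (auto simp: g1_def)
  finally have "norm (k2 - g1) \<le> L * (q + h * M)" .
  then have "norm (a + (h * \<theta>) *\<^sub>R k2 - y1) \<le> q + h * (L * (q + h * M))"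
    by (rule perturb)
  then have "norm (k3 - g1) \<le> L * (q + h * (L * (q + h * M)))"
    unfolding k3_def g1_def using lip nonneg by (blast intro: order.trans mult_left_mono)
  then have "norm (a + (h * \<theta>) *\<^sub>R k3 - y1) \<le> q + h * (L * (q + h * (L * (q + h * M))))"
    by (rule perturb)
  also have "\<dots> = q + h * (L * q) + h\<^sup>2 * (L\<^sup>2 * q) + h ^ 3 * (L\<^sup>2 * M)"
    by (simp add: power2_eq_square power3_eq_cube algebra_simps)
  \<comment> \<open>Here p \<le> 2 enters: h ^ 3 \<le> h ^ (p + 1) for h \<le> 1.\<close>
  also have "\<dots> \<le> q + 1 * (L * q) + 1 * (L\<^sup>2 * q) + h ^ (p + 1) * (L\<^sup>2 * M)"
    using h nonneg q0 p by (intro add_mono mult_right_mono power_decreasing power_le_one) auto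
  also have "\<dots> = (Q + L * Q + L\<^sup>2 * Q + L\<^sup>2 * M) * h ^ (p + 1)"
    by (simp add: q_def algebra_simps)
  finally show ?thesis by (simp add: step)
qed

text \<open>Because of the delay a new error depends on the whole past, so \<open>step\<close>
  assumes a common bound \<open>E\<close> for all earlier errors. The claimed bound is nondecreasing
  in its index, hence its value at \<open>k\<close> covers all errors up to \<open>k\<close>, and
  strong induction applies.\<close>

lemma discrete_gronwall_history:
  fixes e :: "nat \<Rightarrow> real"
  assumes "e 0 \<le> 0" "0 \<le> K" "0 \<le> D"
    and step: "\<And>n E. n < N \<Longrightarrow> (\<And>j. j \<le> n \<Longrightarrow> e j \<le> E) \<Longrightarrow> e (n + 1) \<le> (1 + K) * E + D"
    and n: "n \<le> N"
  shows "e n \<le> real n * D * (1 + K) ^ n"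
  using n
proof (induction n rule: less_induct)
  case (less n)
  show ?case
  proof (cases n)
    case 0
    then show ?thesis using assms by simp
  next
    case (Suc k)
    have "e j \<le> real k * D * (1 + K) ^ k" if "j \<le> k" for j
    proof -
      have "e j \<le> real j * D * (1 + K) ^ j"
        using less that Suc by auto
      also have "\<dots> \<le> real k * D * (1 + K) ^ k"
        using that assms by (intro mult_mono power_increasing) auto
      finally show ?thesis .
    qed
    then have "e (k + 1) \<le> (1 + K) * (real k * D * (1 + K) ^ k) + D * 1"
      using step[of k] less.prems Suc by simp
    also have "\<dots> \<le> (1 + K) * (real k * D * (1 + K) ^ k) + D * (1 + K) ^ (k + 1)"
      using assms by (intro add_left_mono mult_left_mono one_le_power) auto
    finally show ?thesis using Suc by (simp add: algebra_simps)
  qed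
qed

text \<open>Reduces order \<open>p\<close> to the accuracy of the quadrature rule along the exact
  solution: \<open>theta_step_consistent\<close> gives the local error,
  \<open>theta_step_stable\<close> its propagation, and the Gronwall argument the accumulation. The
  constant \<open>Q\<close> is the same for all grids, hence so is the final one.\<close>

lemma theta_method_convergence:
  fixes f :: "'v::real_normed_vector dde_rhs"
  assumes pos: "0 < \<tau>" "0 < T" and \<theta>: "0 \<le> \<theta>" "\<theta> \<le> 1" and p: "p \<le> 2"
    and lip: "\<And>t x1 x2 u1 u2. t \<in> {0..T} \<Longrightarrow>
      norm (f t x1 u1 - f t x2 u2) \<le> L * norm (x1 - x2) + L * norm (u1 - u2)"
    and bd: "\<And>t x u. t \<in> {0..T} \<Longrightarrow> norm (f t x u) \<le> M"
    and nonneg: "0 \<le> L" "0 \<le> M" "0 \<le> Q"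
    and sol: "dde_solution \<tau> T f \<phi> y"
    and g: "\<And>t. g t = f t (y t) (y (t - \<tau>))"
    and quad: "\<And>h m N n. uniform_grid \<tau> T h m N \<Longrightarrow> n < N \<Longrightarrow>
      norm (y (real (n + 1) * h) - y (real n * h) - (h * (1 - \<theta>)) *\<^sub>R g (real n * h)
        - (h * \<theta>) *\<^sub>R g (real (n + 1) * h)) \<le> Q * h ^ (p + 1)"
  shows "\<exists>C>0. \<exists>h0>0. \<forall>h m N Y.
        uniform_grid \<tau> T h m N \<and> h \<le> h0 \<and> theta_method \<tau> \<theta> f \<phi> h m N Y \<longrightarrow>
        (\<forall>n\<le>N. norm (Y n - y (real n * h)) \<le> C * h ^ p)"
proof -
  define K where "K = 2 * L * (1 + L)\<^sup>2"
  define D where "D = Q + L * Q + L\<^sup>2 * Q + L\<^sup>2 * M"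
  have K0: "0 \<le> K" and D0: "0 \<le> D"
    using nonneg by (auto simp: K_def D_def)
  \<comment> \<open>The added 1 makes the constant positive even if \<open>D\<close> is 0.\<close>
  have bound: "norm (Y n - y (real n * h)) \<le> (T * D * exp (T * K) + 1) * h ^ p"
    if grid: "uniform_grid \<tau> T h m N" and h1: "h \<le> 1" and meth: "theta_method \<tau> \<theta> f \<phi> h m N Y"
      and nN: "n \<le> N" for h m N Y n
  proof -
    have h0: "0 < h" and \<tau>: "\<tau> = real m * h" and T: "T = real N * h"
      using grid by (auto simp: uniform_grid_def)
    \<comment> \<open>A positive \<open>m\<close> keeps the delayed index n + 1 - m within the past,
      at most \<open>n\<close>.\<close>
    have m0: "0 < m" using pos \<tau> by (cases m) auto
    have in_T: "real j * h \<in> {0..T}" if "j \<le> N" for j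
      using that h0 by (auto simp: T intro: mult_right_mono)
    define e where "e j = norm (Y j - y (real j * h))" for j
    define \<nu> where "\<nu> j = y (real j * h - \<tau>)" for j
    let ?\<nu> = "delay_approx \<tau> \<phi> h m Y"
    have "e n \<le> real n * (D * h ^ (p + 1)) * (1 + h * K) ^ n"
    proof (rule discrete_gronwall_history[OF _ _ _ _ nN])
      show "e 0 \<le> 0"
        using meth sol pos by (auto simp: e_def theta_method_def dde_solution_def)
      show "0 \<le> h * K" "0 \<le> D * h ^ (p + 1)" using h0 K0 D0 by auto
    next
      fix n E assume n: "n < N" and E: "\<And>j. j \<le> n \<Longrightarrow> e j \<le> E"
      have E0: "0 \<le> E" using E[of 0] unfolding e_def by (meson le0 norm_ge_zero order.trans)
      have delay: "norm (?\<nu> j - \<nu> j) \<le> E" if "j \<le> n + 1" for j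
      proof (cases "m \<le> j")
        case True
        then have "real j * h - \<tau> = real (j - m) * h"
          by (simp add: \<tau> of_nat_diff algebra_simps)
        then show ?thesis
          using True E[of "j - m"] that m0 by (simp add: delay_approx_def \<nu>_def e_def)
      next
        \<comment> \<open>Before index \<open>m\<close> the method reads the history itself, which
          is exact.\<close>
        case False
        then have "real j * h \<le> real m * h" using h0 by (intro mult_right_mono) auto
        then have "real j * h - \<tau> \<in> {-\<tau>..0}" using h0 by (auto simp: \<tau>)
        then have "\<nu> j = \<phi> (real j * h - \<tau>)"
          using sol by (auto simp: \<nu>_def dde_solution_def)
        then show ?thesis using False E0 by (simp add: delay_approx_def)
      qed
      have t: "t \<in> {0..T}" if "t \<in> {real n * h, real (n + 1) * h}" for t
        using that in_T[of n] in_T[of "n + 1"] n by auto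
      \<comment> \<open>The new error splits into the difference of two method steps, from computed
        and from exact data, and the local error of the step from exact data.\<close>
      have "norm (theta_step \<theta> f h ?\<nu> n (Y n) - theta_step \<theta> f h \<nu> n (y (real n * h)))
          \<le> (1 + h * (2 * L * (1 + L)\<^sup>2)) * E"
        using E[of n] delay h0 h1 by (intro theta_step_stable lip t nonneg \<theta>) (auto simp: e_def)
      moreover have "norm (theta_step \<theta> f h \<nu> n (y (real n * h)) - y (real (n + 1) * h)) \<le> D * h ^ (p + 1)"
        unfolding D_def
      proof (rule theta_step_consistent[OF _ bd nonneg \<theta> _ h1 p])
        show "norm (f (real (n + 1) * h) x1 u - f (real (n + 1) * h) x2 u) \<le> L * norm (x1 - x2)" for x1 x2 u
          using lip[OF t, of "real (n + 1) * h" x1 u x2 u] by simp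
        show "norm (y (real (n + 1) * h) - y (real n * h) - (h * (1 - \<theta>)) *\<^sub>R f (real n * h) (y (real n * h)) (\<nu> n)
          - (h * \<theta>) *\<^sub>R f (real (n + 1) * h) (y (real (n + 1) * h)) (\<nu> (n + 1))) \<le> Q * h ^ (p + 1)"
          using quad[OF grid n] by (simp add: g \<nu>_def)
      qed (use t h0 in auto)
      moreover have "Y (n + 1) = theta_step \<theta> f h ?\<nu> n (Y n)"
        using meth n by (simp add: theta_method_def)
      ultimately show "e (n + 1) \<le> (1 + h * K) * E + D * h ^ (p + 1)"
        unfolding e_def K_def by (metis (no_types, lifting) norm_diff_triangle_le)
    qed
    \<comment> \<open>At most \<open>N\<close> local errors of size h ^ (p + 1) accumulate, and N *
      h = T trades one factor \<open>h\<close> for \<open>T\<close>.\<close>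
    also have "\<dots> \<le> real N * (D * h ^ (p + 1)) * exp (T * K)"
    proof (intro mult_mono)
      have "(1 + h * K) ^ n \<le> exp (h * K) ^ n"
        using h0 K0 by (intro power_mono exp_ge_add_one_self) auto
      also have "\<dots> = exp (real n * h * K)"
        by (simp add: exp_of_nat_mult[symmetric] ac_simps)
      also have "\<dots> \<le> exp (T * K)"
        using in_T[OF nN] K0 by (auto intro: mult_right_mono)
      finally show "(1 + h * K) ^ n \<le> exp (T * K)" .
    qed (use nN h0 D0 K0 in auto)
    also have "\<dots> = (T * D * exp (T * K)) * h ^ p"
      by (simp add: T)
    also have "\<dots> \<le> (T * D * exp (T * K) + 1) * h ^ p"
      using h0 by (intro mult_right_mono) auto
    finally show ?thesis by (simp add: e_def)
  qed
  have "0 < T * D * exp (T * K) + 1" using pos D0 by (simp add: add_nonneg_pos)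
  then show ?thesis using bound zero_less_one by blast
qed

section \<open>Regularity of the solution and orders of convergence\<close>

lemma admissible_rhs_lipschitz:
  fixes f :: "'v::real_normed_vector dde_rhs"
  assumes "admissible_rhs T f"
  shows "\<exists>L\<ge>0. \<forall>t\<in>{0..T}. \<forall>x1 x2 u1 u2.
    norm (f t x1 u1 - f t x2 u2) \<le> L * norm (x1 - x2) + L * norm (u1 - u2)"
proof -
  obtain L1 L2 where L1: "L1 > 0" "\<And>t x1 x2 u. t \<in> {0..T} \<Longrightarrow> norm (f t x1 u - f t x2 u) \<le> L1 * norm (x1 - x2)"
    and L2: "L2 > 0" "\<And>t x u1 u2. t \<in> {0..T} \<Longrightarrow> norm (f t x u1 - f t x u2) \<le> L2 * norm (u1 - u2)"
    using assms unfolding admissible_rhs_def by blast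
  have "norm (f t x1 u1 - f t x2 u2) \<le> (L1 + L2) * norm (x1 - x2) + (L1 + L2) * norm (u1 - u2)"
    if t: "t \<in> {0..T}" for t x1 x2 u1 u2
  proof -
    have "norm (f t x1 u1 - f t x2 u2) \<le> norm (f t x1 u1 - f t x2 u1) + norm (f t x2 u1 - f t x2 u2)"
      using norm_triangle_ineq[of "f t x1 u1 - f t x2 u1" "f t x2 u1 - f t x2 u2"] by simp
    also have "\<dots> \<le> (L1 + L2) * norm (x1 - x2) + (L1 + L2) * norm (u1 - u2)"
      using L1 L2 by (intro add_mono order.trans[OF L1(2)[OF t]] order.trans[OF L2(2)[OF t]] mult_right_mono) auto
    finally show ?thesis .
  qed
  then show ?thesis using L1(1) L2(1) by (intro exI[of _ "L1 + L2"]) auto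
qed

lemma admissible_rhs_bounded:
  fixes f :: "'v::real_normed_vector dde_rhs"
  assumes "admissible_rhs T f"
  shows "\<exists>M\<ge>0. \<forall>t\<in>{0..T}. \<forall>x u. norm (f t x u) \<le> M"
proof -
  obtain M where "\<forall>p\<in>dde_domain T. norm ((\<lambda>(t, x, u). f t x u) p) \<le> M"
    using assms unfolding admissible_rhs_def bounded_iff by auto
  then have "norm (f t x u) \<le> M" if "t \<in> {0..T}" for t x u
    using that by (auto simp: dde_domain_def)
  then have "norm (f t x u) \<le> \<bar>M\<bar>" if "t \<in> {0..T}" for t x u
    using that by (meson abs_ge_self order.trans)
  then show ?thesis by (intro exI[of _ "\<bar>M\<bar>"]) auto
qed

text \<open>Boundedness of \<open>f\<close> bounds the derivative on [0,T], and the C^1 history is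
  Lipschitz on [-\<tau>,0]. The pieces are glued at 0, where the values agree although the
  derivatives may differ.\<close>

lemma dde_solution_lipschitz:
  fixes f :: "'v::real_normed_vector dde_rhs"
  assumes pos: "0 < \<tau>" "0 < T" and adm: "admissible_rhs T f"
    and \<phi>: "Ck_on (Suc 0) {-\<tau>..0} \<phi>" and sol: "dde_solution \<tau> T f \<phi> y"
  shows "\<exists>L. L-lipschitz_on {-\<tau>..T} y"
proof -
  obtain M where M: "M \<ge> 0" "\<And>t x u. t \<in> {0..T} \<Longrightarrow> norm (f t x u) \<le> M"
    using admissible_rhs_bounded[OF adm] by blast
  have "M-lipschitz_on {0..T} y"
    by (rule lipschitz_on_has_vector_derivative_bound[where g = "\<lambda>t. f t (y t) (y (t - \<tau>))"])
      (use M sol in \<open>auto simp: dde_solution_def\<close>)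
  moreover obtain L where "L-lipschitz_on {-\<tau>..0} \<phi>"
    using Ck_on_1_imp_lipschitz_on_compact[OF \<phi>, of "{-\<tau>..0}"] by auto
  moreover have "\<phi> 0 = y 0" using sol pos by (simp add: dde_solution_def)
  ultimately have "(max L M)-lipschitz_on {-\<tau>..T} (\<lambda>t. if t \<le> 0 then \<phi> t else y t)"
    by (intro lipschitz_on_concat_max)
  then have "(max L M)-lipschitz_on {-\<tau>..T} y"
    by (rule lipschitz_on_transform) (use sol in \<open>auto simp: dde_solution_def\<close>)
  then show ?thesis by blast
qed

text \<open>The domain is unbounded, but the curve stays in a compact convex product of an interval
  and two balls, where a C^1 function is Lipschitz. This is applied both to the right-hand side and
  to its directional derivatives.\<close>

lemma lipschitz_on_delay_curve:
  fixes y :: "real \<Rightarrow> 'v::euclidean_space" and F :: "real \<times> 'v \<times> 'v \<Rightarrow> 'b::real_normed_vector"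
  assumes "0 \<le> \<tau>" and y: "\<exists>L. L-lipschitz_on {-\<tau>..T} y"
    and F: "Ck_on (Suc 0) (dde_domain T) F"
  shows "\<exists>L. L-lipschitz_on {0..T} (\<lambda>t. F (t, y t, y (t - \<tau>)))"
proof -
  obtain L where L: "L-lipschitz_on {-\<tau>..T} y" using y by blast
  have "bounded (y ` {-\<tau>..T})"
    using lipschitz_on_continuous_on[OF L]
    by (intro compact_imp_bounded compact_continuous_image) auto
  then obtain R where R: "\<And>t. t \<in> {-\<tau>..T} \<Longrightarrow> norm (y t) \<le> R"
    unfolding bounded_iff by blast
  let ?K = "{0..T} \<times> cball (0::'v) R \<times> cball (0::'v) R"
  obtain B where B: "B-lipschitz_on ?K F"
    using Ck_on_1_imp_lipschitz_on_compact[OF F, of ?K]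
    by (force simp: dde_domain_def intro!: compact_Times convex_Times)
  have L1: "L-lipschitz_on {0..T} y"
    by (rule lipschitz_on_subset[OF L]) (use assms in auto)
  have L2: "L-lipschitz_on {0..T} (\<lambda>t. y (t - \<tau>))"
    using lipschitz_on_nonneg[OF L] assms
    by (intro lipschitz_onI order.trans[OF lipschitz_onD[OF L]]) (auto simp: dist_norm)
  obtain C where C: "C-lipschitz_on {0..T} (\<lambda>t. (t, y t, y (t - \<tau>)))"
    using lipschitz_on_Pair[OF lipschitz_on_id lipschitz_on_Pair[OF L1 L2]] by blast
  have "(\<lambda>t. (t, y t, y (t - \<tau>))) ` {0..T} \<subseteq> ?K"
    using assms(1) R by (auto simp: mem_cball_0)
  with lipschitz_on_compose2[OF C lipschitz_on_subset[OF B]] show ?thesis by blast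
qed

text \<open>The rectangle rule at \<open>a\<close> errs by at most
  \<open>L * (b - a)\<^sup>2\<close>, and moving the share \<theta> of the weight from
  \<open>a\<close> to \<open>b\<close> costs at most that much again.\<close>

lemma theta_rule_error:
  fixes y :: "real \<Rightarrow> 'b::real_normed_vector"
  assumes \<theta>: "0 \<le> \<theta>" "\<theta> \<le> 1" and ab: "a \<le> b"
    and y: "\<And>t. t \<in> {a..b} \<Longrightarrow> (y has_vector_derivative g t) (at t within {a..b})"
    and L: "L-lipschitz_on {a..b} g"
  shows "norm (y b - y a - ((b - a) * (1 - \<theta>)) *\<^sub>R g a - ((b - a) * \<theta>) *\<^sub>R g b) \<le> 2 * L * (b - a)\<^sup>2"
proof -
  have L0: "L \<ge> 0" using L lipschitz_on_nonneg by auto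
  have gL: "norm (g t - g a) \<le> L * (b - a)" if "t \<in> {a..b}" for t
    using lipschitz_onD[OF L that, of a] that mult_left_mono[OF _ L0, of "t - a" "b - a"]
    by (simp add: dist_norm)
  have "(L * (b - a))-lipschitz_on {a..b} (\<lambda>t. y t - t *\<^sub>R g a)"
  proof (rule lipschitz_on_has_vector_derivative_bound[where g = "\<lambda>t. g t - g a"])
    fix s assume s: "s \<in> {a..b}"
    show "((\<lambda>t. y t - t *\<^sub>R g a) has_vector_derivative g s - g a) (at s within {a..b})"
      by (rule derivative_eq_intros y[OF s] refl | simp)+
  qed (use ab L0 gL in auto)
  from lipschitz_onD[OF this, of b a]
  have y_err: "norm (y b - y a - (b - a) *\<^sub>R g a) \<le> L * (b - a) * (b - a)"
    using ab by (simp add: dist_norm algebra_simps)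
  have "y b - y a - ((b - a) * (1 - \<theta>)) *\<^sub>R g a - ((b - a) * \<theta>) *\<^sub>R g b
      = (y b - y a - (b - a) *\<^sub>R g a) - ((b - a) * \<theta>) *\<^sub>R (g b - g a)"
    by (simp add: algebra_simps)
  also have "norm \<dots> \<le> L * (b - a) * (b - a) + ((b - a) * 1) * (L * (b - a))"
  proof (rule order.trans[OF norm_triangle_ineq4 add_mono[OF y_err]])
    have "(b - a) * \<theta> * norm (g b - g a) \<le> ((b - a) * 1) * (L * (b - a))"
      using gL[of b] ab \<theta> by (intro mult_mono) auto
    then show "norm (((b - a) * \<theta>) *\<^sub>R (g b - g a)) \<le> ((b - a) * 1) * (L * (b - a))"
      using ab \<theta> by simp
  qed
  finally show ?thesis by (simp add: power2_eq_square)
qed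

text \<open>Where the delayed solution has a Lipschitz derivative \<zeta>, the chain rule along the
  curve \<gamma> yields a Lipschitz derivative of \<open>g\<close>, so the trapezoidal rule has
  cubic error. Working on a subinterval allows for a kink of the delayed solution at \<tau>.\<close>

lemma trapezoid_error_smooth_delay:
  fixes f :: "'v::euclidean_space dde_rhs"
  assumes "0 \<le> \<tau>" and f: "Ck_on 2 (dde_domain T) (\<lambda>(t, x, u). f t x u)"
    and y: "\<exists>L. L-lipschitz_on {-\<tau>..T} y"
    and y': "\<And>t. t \<in> {0..T} \<Longrightarrow> (y has_vector_derivative g t) (at t within {0..T})"
    and g: "\<And>t. g t = f t (y t) (y (t - \<tau>))"
    and I: "{\<alpha>..\<beta>} \<subseteq> {0..T}"
    and \<zeta>: "\<And>t. t \<in> {\<alpha>..\<beta>} \<Longrightarrow> ((\<lambda>t. y (t - \<tau>)) has_vector_derivative \<zeta> t) (at t within {\<alpha>..\<beta>})"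
    and \<zeta>L: "\<exists>L. L-lipschitz_on {\<alpha>..\<beta>} \<zeta>"
  shows "\<exists>Q. \<forall>a b. \<alpha> \<le> a \<and> a \<le> b \<and> b \<le> \<beta> \<longrightarrow>
    norm (y b - y a - ((b - a) / 2) *\<^sub>R (g a + g b)) \<le> Q * (b - a) ^ 3"
proof -
  define F where "F = (\<lambda>(t, x, u). f t x u)"
  define \<gamma> where "\<gamma> t = (t, y t, y (t - \<tau>))" for t
  have gF: "g = (\<lambda>t. F (\<gamma> t))"
    by (auto simp: F_def \<gamma>_def g)
  have C2: "Ck_on (Suc (Suc 0)) (dde_domain T) F"
    using f by (simp add: F_def numeral_2_eq_2)
  then obtain F' where F': "\<And>p. p \<in> dde_domain T \<Longrightarrow> (F has_derivative F' p) (at p within dde_domain T)"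
    and C1: "\<And>v. Ck_on (Suc 0) (dde_domain T) (\<lambda>p. F' p v)"
    using Ck_on.simps(2)[of "Suc 0" "dde_domain T" F] by auto
  define V where "V t = (1::real, g t, \<zeta> t)" for t
  define g' where "g' t = F' (\<gamma> t) (V t)" for t
  have dom: "\<gamma> t \<in> dde_domain T" if "t \<in> {\<alpha>..\<beta>}" for t
    using that I by (auto simp: \<gamma>_def dde_domain_def)
  have \<gamma>': "(\<gamma> has_vector_derivative V t) (at t within {\<alpha>..\<beta>})" if t: "t \<in> {\<alpha>..\<beta>}" for t
  proof -
    have "(y has_vector_derivative g t) (at t within {\<alpha>..\<beta>})"
      using has_vector_derivative_within_subset[OF y' I] t I by blast
    then show ?thesis
      unfolding \<gamma>_def V_def using \<zeta>[OF t]
      by (intro has_vector_derivative_Pair has_vector_derivative_id)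
  qed
  have gd: "(g has_vector_derivative g' t) (at t within {\<alpha>..\<beta>})" if t: "t \<in> {\<alpha>..\<beta>}" for t
  proof -
    have "\<gamma> ` {\<alpha>..\<beta>} \<subseteq> dde_domain T" using dom by blast
    then have "(F has_derivative F' (\<gamma> t)) (at (\<gamma> t) within \<gamma> ` {\<alpha>..\<beta>})"
      using has_derivative_subset F' dom[OF t] by blast
    from vector_derivative_diff_chain_within[OF \<gamma>'[OF t] this]
    show ?thesis by (simp add: gF g'_def o_def)
  qed
  obtain Lg where "Lg-lipschitz_on {0..T} g"
    using lipschitz_on_delay_curve[OF assms(1) y Ck_on_SucD[OF C2]] unfolding gF \<gamma>_def by blast
  then have Lg: "Lg-lipschitz_on {\<alpha>..\<beta>} g" using I lipschitz_on_subset by blast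
  obtain L\<zeta> where "L\<zeta>-lipschitz_on {\<alpha>..\<beta>} \<zeta>" using \<zeta>L by blast
  then have V: "\<exists>L. L-lipschitz_on {\<alpha>..\<beta>} V"
    unfolding V_def using lipschitz_on_Pair[OF lipschitz_on_constant lipschitz_on_Pair[OF Lg]] by blast
  \<comment> \<open>\<open>Ck_on\<close> controls \<open>F'\<close> in fixed directions only, while
    \<open>V t\<close> moves; expanding \<open>V t\<close> in the basis leaves a sum of products of
    Lipschitz functions.\<close>
  have "\<exists>L. L-lipschitz_on {\<alpha>..\<beta>} (\<lambda>t. \<Sum>b\<in>Basis. (V t \<bullet> b) *\<^sub>R F' (\<gamma> t) b)"
  proof (rule lipschitz_on_sum, rule lipschitz_on_scaleR_compact)
    fix b :: "real \<times> 'v \<times> 'v"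
    obtain L where L: "L-lipschitz_on {\<alpha>..\<beta>} V" using V by blast
    obtain B where "B-lipschitz_on (V ` {\<alpha>..\<beta>}) (\<lambda>v. v \<bullet> b)"
      using bounded_linear.lipschitz_boundE[OF bounded_linear_inner_left] by blast
    with lipschitz_on_compose2[OF L] show "\<exists>L. L-lipschitz_on {\<alpha>..\<beta>} (\<lambda>t. V t \<bullet> b)" by blast
    show "\<exists>L. L-lipschitz_on {\<alpha>..\<beta>} (\<lambda>t. F' (\<gamma> t) b)"
      using lipschitz_on_delay_curve[OF assms(1) y C1[of b]] I lipschitz_on_subset
      unfolding \<gamma>_def by blast
  qed auto
  then obtain L where "L-lipschitz_on {\<alpha>..\<beta>} (\<lambda>t. \<Sum>b\<in>Basis. (V t \<bullet> b) *\<^sub>R F' (\<gamma> t) b)"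
    by blast
  then have "L-lipschitz_on {\<alpha>..\<beta>} g'"
  proof (rule lipschitz_on_transform)
    fix t assume t: "t \<in> {\<alpha>..\<beta>}"
    have lin: "linear (F' (\<gamma> t))" using F'[OF dom[OF t]] has_derivative_linear by blast
    have "g' t = F' (\<gamma> t) (\<Sum>b\<in>Basis. (V t \<bullet> b) *\<^sub>R b)"
      by (simp add: g'_def euclidean_representation)
    also have "\<dots> = (\<Sum>b\<in>Basis. (V t \<bullet> b) *\<^sub>R F' (\<gamma> t) b)"
      by (simp add: linear_sum[OF lin] linear_scale[OF lin])
    finally show "g' t = (\<Sum>b\<in>Basis. (V t \<bullet> b) *\<^sub>R F' (\<gamma> t) b)" .
  qed
  then have L: "L-lipschitz_on {\<alpha>..\<beta>} g'" .
  show ?thesis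
  proof (intro exI[of _ "2 * L"] allI impI)
    fix a b assume ab: "\<alpha> \<le> a \<and> a \<le> b \<and> b \<le> \<beta>"
    then have sub: "{a..b} \<subseteq> {\<alpha>..\<beta>}" by auto
    show "norm (y b - y a - ((b - a) / 2) *\<^sub>R (g a + g b)) \<le> 2 * L * (b - a) ^ 3"
    proof (rule trapezoid_error)
      show "(y has_vector_derivative g t) (at t within {a..b})" if "t \<in> {a..b}" for t
        using has_vector_derivative_within_subset[OF y', of t "{a..b}"] that sub I by blast
      show "(g has_vector_derivative g' t) (at t within {a..b})" if "t \<in> {a..b}" for t
        using has_vector_derivative_within_subset[OF gd sub] that sub by blast
    qed (use ab lipschitz_on_subset[OF L sub] in auto)
  qed
qed

text \<open>Since \<tau> is the multiple \<open>m\<close> of the step size, every cell lies on one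
  side of it; estimates on either side of the kink at \<tau> therefore cover all cells.\<close>

lemma uniform_grid_index:
  assumes "uniform_grid \<tau> T h m N" "n < N"
  shows "0 \<le> real n * h" "real n * h \<le> real (n + 1) * h" "real (n + 1) * h \<le> T"
    "real (n + 1) * h \<le> \<tau> \<or> \<tau> \<le> real n * h" "real (n + 1) * h - real n * h = h"
proof -
  have h: "0 < h" "\<tau> = real m * h" "T = real N * h"
    using assms by (auto simp: uniform_grid_def)
  show "0 \<le> real n * h" "real n * h \<le> real (n + 1) * h" "real (n + 1) * h \<le> T"
    using assms h by (auto intro!: mult_right_mono)
  have "n + 1 \<le> m \<or> m \<le> n" by linarith
  then show "real (n + 1) * h \<le> \<tau> \<or> \<tau> \<le> real n * h"
    unfolding h(2) using h(1) by (metis less_eq_real_def mult_right_mono of_nat_mono)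
  show "real (n + 1) * h - real n * h = h" by (simp add: algebra_simps)
qed

section \<open>The claimed orders are attained\<close>

lemma theta_method_convergence_order_ge_1:
  assumes pos: "0 < \<tau>" "0 < T" and \<theta>: "0 \<le> \<theta>" "\<theta> \<le> 1"
  shows "convergence_order_ge \<tau> T (theta_method \<tau> \<theta> :: 'v::euclidean_space dde_method) 1"
  unfolding convergence_order_ge_def
proof (intro allI impI; elim conjE)
  fix f :: "'v dde_rhs" and \<phi> y
  assume adm: "admissible_rhs T f" and f: "Ck_on 1 (dde_domain T) (\<lambda>(t, x, u). f t x u)"
    and \<phi>: "Ck_on 1 {-\<tau>..0} \<phi>" and sol: "dde_solution \<tau> T f \<phi> y"
  define g where "g t = f t (y t) (y (t - \<tau>))" for t
  obtain L where L: "L \<ge> 0" "\<And>t x1 x2 u1 u2. t \<in> {0..T} \<Longrightarrow>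
    norm (f t x1 u1 - f t x2 u2) \<le> L * norm (x1 - x2) + L * norm (u1 - u2)"
    using admissible_rhs_lipschitz[OF adm] by blast
  obtain M where M: "M \<ge> 0" "\<And>t x u. t \<in> {0..T} \<Longrightarrow> norm (f t x u) \<le> M"
    using admissible_rhs_bounded[OF adm] by blast
  have yL: "\<exists>L. L-lipschitz_on {-\<tau>..T} y"
    using \<phi> by (intro dde_solution_lipschitz[OF pos adm _ sol]) simp
  obtain Lg where Lg: "Lg-lipschitz_on {0..T} g"
    using lipschitz_on_delay_curve[OF _ yL, of "\<lambda>(t, x, u). f t x u"] f pos
    by (auto simp: g_def[abs_def])
  show "\<exists>C>0. \<exists>h0>0. \<forall>h m N Y.
        uniform_grid \<tau> T h m N \<and> h \<le> h0 \<and> theta_method \<tau> \<theta> f \<phi> h m N Y \<longrightarrow>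
        (\<forall>n\<le>N. norm (Y n - y (real n * h)) \<le> C * h ^ 1)"
  proof (rule theta_method_convergence[where L = L and M = M and g = g and Q = \<open>2 * Lg\<close>, OF pos \<theta> _ L(2) M(2) L(1) M(1) _ sol g_def])
    show "0 \<le> 2 * Lg" using lipschitz_on_nonneg[OF Lg] by simp
    fix h m N n assume grid: "uniform_grid \<tau> T h m N" "n < N"
    note idx = uniform_grid_index[OF grid]
    have sub: "{real n * h..real (n + 1) * h} \<subseteq> {0..T}" using idx by auto
    have "norm (y (real (n + 1) * h) - y (real n * h)
        - ((real (n + 1) * h - real n * h) * (1 - \<theta>)) *\<^sub>R g (real n * h)
        - ((real (n + 1) * h - real n * h) * \<theta>) *\<^sub>R g (real (n + 1) * h))
        \<le> 2 * Lg * (real (n + 1) * h - real n * h)\<^sup>2"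
    proof (rule theta_rule_error[OF \<theta> idx(2)])
      fix t assume "t \<in> {real n * h..real (n + 1) * h}"
      then show "(y has_vector_derivative g t) (at t within {real n * h..real (n + 1) * h})"
        using has_vector_derivative_within_subset[OF _ sub] sub sol
        unfolding dde_solution_def g_def by blast
    qed (use Lg sub lipschitz_on_subset in blast)
    then show "norm (y (real (n + 1) * h) - y (real n * h) - (h * (1 - \<theta>)) *\<^sub>R g (real n * h)
        - (h * \<theta>) *\<^sub>R g (real (n + 1) * h)) \<le> 2 * Lg * h ^ (1 + 1)"
      unfolding idx(5) by (simp add: power2_eq_square)
  qed auto
qed

text \<open>There are two regimes: up to \<tau> the delayed solution is the history, with the
  derivative of \<phi>, and after \<tau> it is the solution itself, with derivative
  \<open>g (t - \<tau>)\<close>. Breaking points at further multiples of \<tau> are harmless,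
  because \<open>g\<close> is Lipschitz on all of [0,T].\<close>

lemma theta_method_half_convergence_order_ge_2:
  assumes pos: "0 < \<tau>" "0 < T"
  shows "convergence_order_ge \<tau> T (theta_method \<tau> (1/2) :: 'v::euclidean_space dde_method) 2"
  unfolding convergence_order_ge_def
proof (intro allI impI; elim conjE)
  fix f :: "'v dde_rhs" and \<phi> y
  assume adm: "admissible_rhs T f" and f: "Ck_on 2 (dde_domain T) (\<lambda>(t, x, u). f t x u)"
    and \<phi>2: "Ck_on 2 {-\<tau>..0} \<phi>" and sol: "dde_solution \<tau> T f \<phi> y"
  have \<phi>: "Ck_on (Suc 0) {-\<tau>..0} \<phi>"
    using \<phi>2 unfolding numeral_2_eq_2 by (rule Ck_on_SucD)
  have f1: "Ck_on (Suc 0) (dde_domain T) (\<lambda>(t, x, u). f t x u)"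
    using f unfolding numeral_2_eq_2 by (rule Ck_on_SucD)
  define g where "g t = f t (y t) (y (t - \<tau>))" for t
  obtain L where L: "L \<ge> 0" "\<And>t x1 x2 u1 u2. t \<in> {0..T} \<Longrightarrow>
    norm (f t x1 u1 - f t x2 u2) \<le> L * norm (x1 - x2) + L * norm (u1 - u2)"
    using admissible_rhs_lipschitz[OF adm] by blast
  obtain M where M: "M \<ge> 0" "\<And>t x u. t \<in> {0..T} \<Longrightarrow> norm (f t x u) \<le> M"
    using admissible_rhs_bounded[OF adm] by blast
  have yL: "\<exists>L. L-lipschitz_on {-\<tau>..T} y"
    by (rule dde_solution_lipschitz[OF pos adm \<phi> sol])
  obtain Lg where Lg: "Lg-lipschitz_on {0..T} g"
    using lipschitz_on_delay_curve[OF _ yL f1] pos by (auto simp: g_def[abs_def])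
  have y': "(y has_vector_derivative g t) (at t within {0..T})" if "t \<in> {0..T}" for t
    using sol that by (auto simp: dde_solution_def g_def)
  \<comment> \<open>\<open>w\<close> represents the solution on the shifted interval: it is \<phi>
    in the first regime and \<open>y\<close> in the second.\<close>
  have shift: "((\<lambda>t. y (t - \<tau>)) has_vector_derivative d) (at t within I)"
    if "(w has_vector_derivative d) (at (t - \<tau>) within J)" "t \<in> I"
      and "\<And>s. s \<in> I \<Longrightarrow> s - \<tau> \<in> J \<and> w (s - \<tau>) = y (s - \<tau>)"
    for w d t I J
  proof -
    have "((\<lambda>t. t - \<tau>) has_vector_derivative 1) (at t within I)"
      by (rule derivative_eq_intros refl | simp)+
    moreover have "(w has_vector_derivative d) (at (t - \<tau>) within (\<lambda>t. t - \<tau>) ` I)"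
      using that by (intro has_vector_derivative_within_subset[OF that(1)]) auto
    ultimately have "((\<lambda>t. w (t - \<tau>)) has_vector_derivative d) (at t within I)"
      using vector_diff_chain_within[of "\<lambda>t. t - \<tau>" 1 t I w d] by (simp add: o_def)
    then show ?thesis
      by (rule has_vector_derivative_transform[rotated 2]) (use that in auto)
  qed
  \<comment> \<open>The minimum is taken because the delay may exceed \<open>T\<close>.\<close>
  have "\<exists>Q. \<forall>a b. 0 \<le> a \<and> a \<le> b \<and> b \<le> min \<tau> T \<longrightarrow>
    norm (y b - y a - ((b - a) / 2) *\<^sub>R (g a + g b)) \<le> Q * (b - a) ^ 3"
  proof -
    have "Ck_on (Suc (Suc 0)) {-\<tau>..0} \<phi>"
      using \<phi>2 by (simp only: numeral_2_eq_2)
    then obtain \<phi>' where \<phi>': "\<And>t. t \<in> {-\<tau>..0} \<Longrightarrow> (\<phi> has_derivative \<phi>' t) (at t within {-\<tau>..0})"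
      and C1: "Ck_on (Suc 0) {-\<tau>..0} (\<lambda>t. \<phi>' t 1)"
      using Ck_on.simps(2)[of "Suc 0" "{-\<tau>..0}" \<phi>] by blast
    obtain B where B: "B-lipschitz_on {-\<tau>..0} (\<lambda>t. \<phi>' t 1)"
      using Ck_on_1_imp_lipschitz_on_compact[OF C1, of "{-\<tau>..0}"] by auto
    have "B-lipschitz_on {0..min \<tau> T} (\<lambda>t. \<phi>' (t - \<tau>) 1)"
      using lipschitz_on_nonneg[OF B]
      by (intro lipschitz_onI order.trans[OF lipschitz_onD[OF B]]) (auto simp: dist_norm)
    moreover have "((\<lambda>t. y (t - \<tau>)) has_vector_derivative \<phi>' (t - \<tau>) 1) (at t within {0..min \<tau> T})"
      if t: "t \<in> {0..min \<tau> T}" for t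
    proof (rule shift[where w = \<phi> and J = "{-\<tau>..0}"])
      have d: "(\<phi> has_derivative \<phi>' (t - \<tau>)) (at (t - \<tau>) within {-\<tau>..0})"
        using \<phi>' t by simp
      \<comment> \<open>On the real line a derivative is multiplication by its value at 1, which
        converts it into a vector derivative.\<close>
      have "\<phi>' (t - \<tau>) r = r *\<^sub>R \<phi>' (t - \<tau>) 1" for r
        using linear_scale[OF has_derivative_linear[OF d], of r 1] by simp
      then have "\<phi>' (t - \<tau>) = (\<lambda>r. r *\<^sub>R \<phi>' (t - \<tau>) 1)" by blast
      with d show "(\<phi> has_vector_derivative \<phi>' (t - \<tau>) 1) (at (t - \<tau>) within {-\<tau>..0})"
        by (simp add: has_vector_derivative_def)
    qed (use t sol in \<open>auto simp: dde_solution_def\<close>)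
    ultimately show ?thesis
      using pos by (intro trapezoid_error_smooth_delay[where f = f and y = y and g = g and \<zeta> = \<open>\<lambda>t. \<phi>' (t - \<tau>) 1\<close>, OF _ f yL y' g_def]) auto
  qed
  then obtain Q1 where Q1: "\<And>a b. 0 \<le> a \<Longrightarrow> a \<le> b \<Longrightarrow> b \<le> min \<tau> T \<Longrightarrow>
    norm (y b - y a - ((b - a) / 2) *\<^sub>R (g a + g b)) \<le> Q1 * (b - a) ^ 3" by blast
  \<comment> \<open>For T < \<tau> the range is empty and the claim vacuous.\<close>
  have "\<exists>Q. \<forall>a b. \<tau> \<le> a \<and> a \<le> b \<and> b \<le> T \<longrightarrow>
    norm (y b - y a - ((b - a) / 2) *\<^sub>R (g a + g b)) \<le> Q * (b - a) ^ 3"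
  proof -
    have "Lg-lipschitz_on {\<tau>..T} (\<lambda>t. g (t - \<tau>))"
      using lipschitz_on_nonneg[OF Lg] pos
      by (intro lipschitz_onI order.trans[OF lipschitz_onD[OF Lg]]) (auto simp: dist_norm)
    moreover have "((\<lambda>t. y (t - \<tau>)) has_vector_derivative g (t - \<tau>)) (at t within {\<tau>..T})"
      if t: "t \<in> {\<tau>..T}" for t
      using t pos by (intro shift[OF y']) auto
    ultimately show ?thesis
      using pos by (intro trapezoid_error_smooth_delay[where f = f and y = y and g = g and \<zeta> = \<open>\<lambda>t. g (t - \<tau>)\<close>, OF _ f yL y' g_def]) auto
  qed
  then obtain Q2 where Q2: "\<And>a b. \<tau> \<le> a \<Longrightarrow> a \<le> b \<Longrightarrow> b \<le> T \<Longrightarrow>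
    norm (y b - y a - ((b - a) / 2) *\<^sub>R (g a + g b)) \<le> Q2 * (b - a) ^ 3" by blast
  define Q where "Q = max 0 (max Q1 Q2)"
  show "\<exists>C>0. \<exists>h0>0. \<forall>h m N Y.
        uniform_grid \<tau> T h m N \<and> h \<le> h0 \<and> theta_method \<tau> (1/2) f \<phi> h m N Y \<longrightarrow>
        (\<forall>n\<le>N. norm (Y n - y (real n * h)) \<le> C * h ^ 2)"
  proof (rule theta_method_convergence[where L = L and M = M and g = g and Q = Q, OF pos _ _ _ L(2) M(2) L(1) M(1) _ sol g_def])
    show "0 \<le> Q" by (simp add: Q_def)
    fix h m N n assume grid: "uniform_grid \<tau> T h m N" "n < N"
    note idx = uniform_grid_index[OF grid]
    define a b where "a = real n * h" and "b = real (n + 1) * h"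
    have "norm (y b - y a - ((b - a) / 2) *\<^sub>R (g a + g b)) \<le> max Q1 Q2 * (b - a) ^ 3"
      using idx(4)
    proof
      assume "real (n + 1) * h \<le> \<tau>"
      then show ?thesis using idx unfolding a_def b_def
        by (intro order.trans[OF Q1] mult_right_mono) auto
    next
      assume "\<tau> \<le> real n * h"
      then show ?thesis using idx unfolding a_def b_def
        by (intro order.trans[OF Q2] mult_right_mono) auto
    qed
    also have "\<dots> \<le> Q * (b - a) ^ 3"
      using idx unfolding a_def b_def Q_def by (intro mult_right_mono) auto
    finally have "norm (y b - y a - (h / 2) *\<^sub>R (g a + g b)) \<le> Q * h ^ 3"
      using idx(5) by (simp add: a_def b_def)
    then show "norm (y (real (n + 1) * h) - y (real n * h) - (h * (1 - 1/2)) *\<^sub>R g (real n * h)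
        - (h * (1/2)) *\<^sub>R g (real (n + 1) * h)) \<le> Q * h ^ (2 + 1)"
      by (simp add: a_def b_def scaleR_add_right diff_diff_eq add.assoc)
  qed auto
qed

section \<open>Optimality of the orders\<close>

lemma Ck_on_const: "Ck_on k S (\<lambda>_. c)"
proof (induction k arbitrary: c)
  case (Suc k)
  then show ?case by (auto intro!: exI[of _ "\<lambda>_ _. 0"])
qed simp

lemma Ck_on_add: "Ck_on k S f \<Longrightarrow> Ck_on k S g \<Longrightarrow> Ck_on k S (\<lambda>x. f x + g x)"
proof (induction k arbitrary: f g)
  case 0
  then show ?case by (simp add: continuous_on_add)
next
  case (Suc k)
  from Suc.prems(1) obtain f' where
    "\<And>x. x \<in> S \<Longrightarrow> (f has_derivative f' x) (at x within S)" "\<And>v. Ck_on k S (\<lambda>x. f' x v)"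
    by auto
  moreover from Suc.prems(2) obtain g' where
    "\<And>x. x \<in> S \<Longrightarrow> (g has_derivative g' x) (at x within S)" "\<And>v. Ck_on k S (\<lambda>x. g' x v)"
    by auto
  ultimately show ?case
    using Suc.IH by (auto intro!: exI[of _ "\<lambda>x v. f' x v + g' x v"] has_derivative_add)
qed

text \<open>\<open>D\<close> lists successive derivatives. Differentiating in direction
  \<open>v\<close> moves to the next member and multiplies \<open>e\<close> by \<open>l v\<close>,
  so the shape is preserved and the induction runs with \<open>D\<close> and \<open>e\<close>
  arbitrary.\<close>

lemma Ck_on_real_comp_linear:
  fixes D :: "nat \<Rightarrow> real \<Rightarrow> real"
  assumes "bounded_linear l" and "\<And>i s. i < k \<Longrightarrow> (D i has_real_derivative D (Suc i) s) (at s)"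
    and "continuous_on UNIV (D k)"
  shows "Ck_on k S (\<lambda>p. D 0 (l p) *\<^sub>R e)"
  using assms(2,3)
proof (induction k arbitrary: D e)
  case 0
  then have "continuous_on S (\<lambda>p. D 0 (l p))"
    using continuous_on_compose2[OF _ linear_continuous_on[OF assms(1)], of UNIV "D 0"] by simp
  then show ?case by (auto intro!: continuous_on_scaleR)
next
  case (Suc k)
  have "((\<lambda>p. D 0 (l p) *\<^sub>R e) has_derivative (\<lambda>v. D (Suc 0) (l p) *\<^sub>R l v *\<^sub>R e)) (at p within S)" for p
  proof -
    have "(D 0 has_derivative (*) (D (Suc 0) (l p))) (at (l p))"
      using Suc.prems(1)[of 0] by (simp add: has_field_derivative_def)
    from has_derivative_compose[OF bounded_linear_imp_has_derivative[OF assms(1)] this]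
    have "((\<lambda>p. D 0 (l p)) has_derivative (\<lambda>v. D (Suc 0) (l p) * l v)) (at p within S)" .
    then show ?thesis by (auto intro: has_derivative_scaleR_left)
  qed
  moreover have "Ck_on k S (\<lambda>p. D (Suc 0) (l p) *\<^sub>R l v *\<^sub>R e)" for v
    using Suc.IH[of "\<lambda>i. D (Suc i)" "l v *\<^sub>R e"] Suc.prems by simp
  ultimately show ?case
    unfolding Ck_on.simps by (intro exI[of _ "\<lambda>p v. D (Suc 0) (l p) *\<^sub>R l v *\<^sub>R e"]) simp
qed

text \<open>At 0 both branches have value 0 and slope 0, so the pieces fit together to first
  order.\<close>

lemma has_real_derivative_cut_off:
  fixes F :: "real \<Rightarrow> real"
  assumes "\<And>s. (F has_real_derivative F' s) (at s)" "F 0 = 0" "F' 0 = 0"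
  shows "((\<lambda>s. if s \<le> 0 then F s else 0) has_real_derivative (if s \<le> 0 then F' s else 0)) (at s)"
proof -
  have "((\<lambda>s. if s \<in> {..0} then F s else 0) has_derivative
      (if s \<in> {..0} then (*) (F' s) else (*) 0)) (at s within {..0} \<union> {0<..})"
  proof (rule has_derivative_If_within_closures)
    show "(F has_derivative (*) (F' s)) (at s within {..0} \<union> (closure {..0} \<inter> closure {0<..}))"
      using assms(1) by (simp add: has_field_derivative_def has_derivative_at_withinI)
    show "((\<lambda>s. 0) has_derivative (*) 0) (at s within {0<..} \<union> (closure {..0} \<inter> closure {0<..}))"
      using has_derivative_const[of "0 :: real"] by (simp add: fun_eq_iff[symmetric] mult_zero_left[abs_def])
  qed (use assms in auto)
  moreover have "{..0} \<union> {0<..} = (UNIV :: real set)" by auto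
  ultimately show ?thesis by (auto simp: has_field_derivative_def split: if_splits)
qed

text \<open>For k \<le> 3, the k-th derivative of the C^3 function that is sin^4 on the negative and 0 on the
  positive half-line.\<close>

definition sin4_cut :: "nat \<Rightarrow> real \<Rightarrow> real" where
  "sin4_cut k s = (if s \<le> 0 then
    [sin s ^ 4,
     4 * sin s ^ 3 * cos s,
     12 * sin s ^ 2 * cos s ^ 2 - 4 * sin s ^ 4,
     24 * sin s * cos s ^ 3 - 40 * sin s ^ 3 * cos s] ! k else 0)"

lemma sin4_cut_derivative:
  assumes "k < 3"
  shows "(sin4_cut k has_real_derivative sin4_cut (Suc k) s) (at s)"
proof -
  consider "k = 0" | "k = 1" | "k = 2" using assms by linarith
  then show ?thesis
  proof cases
    case 1
    show ?thesis unfolding sin4_cut_def 1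
      by (rule has_real_derivative_cut_off)
        (auto intro!: derivative_eq_intros simp: power_numeral_reduce algebra_simps)
  next
    case 2
    show ?thesis unfolding sin4_cut_def 2
      by (rule has_real_derivative_cut_off)
        (auto intro!: derivative_eq_intros simp: power_numeral_reduce algebra_simps)
  next
    case 3
    show ?thesis unfolding sin4_cut_def 3
      by (rule has_real_derivative_cut_off)
        (auto intro!: derivative_eq_intros simp: power_numeral_reduce algebra_simps)
  qed
qed

lemma sin4_cut_continuous:
  assumes "k \<le> 3"
  shows "continuous_on UNIV (sin4_cut k)"
proof (cases "k = 3")
  case True
  have "continuous_on ({..0} \<union> {0..}) (\<lambda>s::real. if s \<le> 0 then 24 * sin s * cos s ^ 3 - 40 * sin s ^ 3 * cos s else 0)"
    by (rule continuous_on_If) (auto intro!: continuous_intros)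
  moreover have "{..0} \<union> {0..} = (UNIV :: real set)" by auto
  moreover have "sin4_cut 3 = (\<lambda>s. if s \<le> 0 then 24 * sin s * cos s ^ 3 - 40 * sin s ^ 3 * cos s else 0)"
    by (rule ext) (simp add: sin4_cut_def numeral_3_eq_3)
  ultimately show ?thesis by (simp add: True)
next
  case False
  then show ?thesis
    using assms by (intro DERIV_continuous_on[OF has_field_derivative_at_within[OF sin4_cut_derivative]]) auto
qed

lemma sin4_cut_nonneg_arg: "0 \<le> s \<Longrightarrow> sin4_cut 0 s = 0"
  by (simp add: sin4_cut_def)

lemma sin4_cut_bounded: "\<bar>sin4_cut 0 s\<bar> \<le> 1"
  using power_le_one[of "\<bar>sin s\<bar>" 4] by (simp add: sin4_cut_def)

lemma sin4_cut_lipschitz: "\<bar>sin4_cut 0 s - sin4_cut 0 t\<bar> \<le> 4 * \<bar>s - t\<bar>"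
proof -
  have "\<bar>sin r\<bar> ^ 3 * \<bar>cos r\<bar> \<le> 1" for r :: real
    by (intro mult_le_one power_le_one) auto
  then have "norm (sin4_cut (Suc 0) r) \<le> 4" for r
    by (auto simp: sin4_cut_def abs_mult power_abs)
  then show ?thesis
    using field_differentiable_bound[of UNIV "sin4_cut 0" "sin4_cut (Suc 0)" 4 s t] sin4_cut_derivative[of 0]
    by auto
qed

section \<open>The method as a quadrature rule, and the test right-hand sides\<close>

lemma theta_step_quadrature:
  fixes e :: "'v::real_vector"
  assumes "\<And>x. f (real n * h) x (\<nu> n) = a *\<^sub>R e" "\<And>x. f (real (n + 1) * h) x (\<nu> (n + 1)) = b *\<^sub>R e"
  shows "theta_step \<theta> f h \<nu> n (x *\<^sub>R e) = (x + (h * (1 - \<theta>) * a + h * \<theta> * b)) *\<^sub>R e"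
  using assms by (simp add: theta_step_def Let_def algebra_simps)

text \<open>The composite rule on \<open>n\<close> cells for the integral of \<open>c\<close> over
  [0, n h]; for \<theta> = 1/2 it is the trapezoidal rule.\<close>

definition theta_sum :: "real \<Rightarrow> (real \<Rightarrow> real) \<Rightarrow> real \<Rightarrow> nat \<Rightarrow> real" where
  "theta_sum \<theta> c h n = (\<Sum>j<n. h * (1 - \<theta>) * c (real j * h) + h * \<theta> * c (real (j + 1) * h))"

text \<open>Where \<open>u \<bullet> e\<close> is nonnegative the second summand vanishes and the
  problem is pure integration of \<open>c\<close>. The sine keeps this summand bounded and
  Lipschitz, and its fourth power makes it C^3, the smoothness required to refute order 3.\<close>

definition cut_rhs :: "(real \<Rightarrow> real) \<Rightarrow> 'v::real_inner \<Rightarrow> 'v dde_rhs" where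
  "cut_rhs c e t x u = (c t + sin4_cut 0 (u \<bullet> e)) *\<^sub>R e"

lemma cut_rhs_Ck_on:
  assumes c: "\<And>i s. (c i has_real_derivative c (Suc i) s) (at s)" and k: "k \<le> 3"
  shows "Ck_on k S (\<lambda>(t, x, u). cut_rhs (c 0) e t x u)"
proof -
  have "Ck_on k S (\<lambda>p. c 0 (fst p) *\<^sub>R e)"
    using c by (intro Ck_on_real_comp_linear bounded_linear_fst DERIV_continuous_on[OF has_field_derivative_at_within])
  moreover have "Ck_on k S (\<lambda>p. sin4_cut 0 (snd (snd p) \<bullet> e) *\<^sub>R e)"
    using k by (intro Ck_on_real_comp_linear[where l = "\<lambda>p. snd (snd p) \<bullet> e"] sin4_cut_derivative sin4_cut_continuous
      bounded_linear_inner_left_comp bounded_linear_compose[OF bounded_linear_snd bounded_linear_snd]) auto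
  ultimately show ?thesis
    using Ck_on_add[of k S "\<lambda>p. c 0 (fst p) *\<^sub>R e" "\<lambda>p. sin4_cut 0 (snd (snd p) \<bullet> e) *\<^sub>R e"]
    by (simp add: cut_rhs_def case_prod_beta' scaleR_add_left)
qed

lemma cut_rhs_admissible:
  fixes e :: "'v::real_inner"
  assumes "0 < T" and c: "\<And>i s. (c i has_real_derivative c (Suc i) s) (at s)" and e: "norm e = 1"
  shows "admissible_rhs T (cut_rhs (c 0) e)"
proof -
  have ee: "e \<bullet> e = 1" using e by (simp add: dot_square_norm)
  have "nonlinear_rhs T (cut_rhs (c 0) e)"
    unfolding nonlinear_rhs_def
  proof
    assume "\<exists>A B d. \<forall>t\<in>{0..T}. linear (A t) \<and> linear (B t) \<and> (\<forall>x u. cut_rhs (c 0) e t x u = A t x + B t u + d t)"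
    then obtain A B d where lin: "linear A" "linear B"
      and eq: "\<And>x u. cut_rhs (c 0) e 0 x u = A x + B u + (d :: 'v)"
      using \<open>0 < T\<close> by fastforce
    \<comment> \<open>Linearity would make the cut-off term a linear map of \<open>u\<close>, yet it
      vanishes at \<open>e\<close> and not at \<open>- e\<close>.\<close>
    have "sin4_cut 0 (u \<bullet> e) *\<^sub>R e = B u" for u
      using eq[of 0 u] eq[of 0 0] linear_0[OF lin(1)] linear_0[OF lin(2)]
      by (simp add: cut_rhs_def sin4_cut_nonneg_arg scaleR_add_left)
    from this[of e] this[of "- e"] have "sin4_cut 0 (- 1) *\<^sub>R e = 0"
      by (simp add: ee sin4_cut_nonneg_arg linear_neg[OF lin(2)])
    moreover have "sin 1 \<noteq> (0 :: real)" using sin_gt_zero[of 1] pi_gt3 by simp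
    ultimately show False using e by (auto simp: sin4_cut_def)
  qed
  moreover have "bounded ((\<lambda>(t, x, u). cut_rhs (c 0) e t x u) ` dde_domain T)"
  proof -
    have "continuous_on {0..T} (c 0)"
      using c by (intro DERIV_continuous_on[OF has_field_derivative_at_within])
    then have "bounded (c 0 ` {0..T})"
      by (intro compact_imp_bounded compact_continuous_image) auto
    then obtain B where B: "\<And>t. t \<in> {0..T} \<Longrightarrow> \<bar>c 0 t\<bar> \<le> B"
      unfolding bounded_iff real_norm_def by blast
    have "norm (cut_rhs (c 0) e t x u) \<le> B + 1" if "t \<in> {0..T}" for t x u
      using B[OF that] sin4_cut_bounded[of "u \<bullet> e"] e by (simp add: cut_rhs_def)
    then show ?thesis unfolding bounded_iff dde_domain_def by fastforce
  qed
  moreover have "continuous_on (dde_domain T) (\<lambda>(t, x, u). cut_rhs (c 0) e t x u)"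
    using Ck_on_imp_continuous_on[OF cut_rhs_Ck_on[where c = c and k = 0, OF c]] by simp
  moreover have "norm (cut_rhs (c 0) e t x u1 - cut_rhs (c 0) e t x u2) \<le> 4 * norm (u1 - u2)" for t x u1 u2
  proof -
    have "cut_rhs (c 0) e t x u1 - cut_rhs (c 0) e t x u2 = (sin4_cut 0 (u1 \<bullet> e) - sin4_cut 0 (u2 \<bullet> e)) *\<^sub>R e"
      by (simp add: cut_rhs_def algebra_simps)
    also have "norm \<dots> \<le> 4 * \<bar>(u1 - u2) \<bullet> e\<bar>"
      using sin4_cut_lipschitz e by (simp add: inner_diff_left)
    also have "\<dots> \<le> 4 * norm (u1 - u2)"
      using Cauchy_Schwarz_ineq2[of "u1 - u2" e] e by simp
    finally show ?thesis .
  qed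
  \<comment> \<open>The left side is 0, so 1 is just a convenient positive constant.\<close>
  moreover have "norm (cut_rhs (c 0) e t x1 u - cut_rhs (c 0) e t x2 u) \<le> 1 * norm (x1 - x2)" for t x1 x2 u
    by (simp add: cut_rhs_def)
  ultimately show ?thesis
    unfolding admissible_rhs_def by (intro conjI exI[of _ "1::real"] exI[of _ "4::real"]) auto
qed

text \<open>On nonnegative multiples of \<open>e\<close> the method computes
  \<open>theta_sum\<close>, so by \<open>err\<close> the error at \<open>T\<close> is exactly
  |\<kappa>| T h^q, which no bound \<open>C * h ^ (q + 1)\<close> allows on fine grids. One given
  grid supplies arbitrarily fine ones; with no grid at all the order bound would hold
  vacuously.\<close>

lemma theta_method_not_convergence_order_ge:
  fixes c :: "nat \<Rightarrow> real \<Rightarrow> real" and P :: "real \<Rightarrow> real"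
  assumes pos: "0 < \<tau>" "0 < T" and grid: "\<exists>h m N. uniform_grid \<tau> T h m N"
    and \<theta>: "0 \<le> \<theta>" "\<theta> \<le> 1" and q: "q \<le> 2" and \<kappa>: "\<kappa> \<noteq> 0"
    and c: "\<And>i s. (c i has_real_derivative c (Suc i) s) (at s)"
    and c_nonneg: "\<And>s. 0 \<le> s \<Longrightarrow> 0 \<le> c 0 s"
    and P: "P 0 = 0" "\<And>t. (P has_real_derivative c 0 t) (at t)" "\<And>t. 0 \<le> t \<Longrightarrow> 0 \<le> P t"
    and err: "\<And>h N. theta_sum \<theta> (c 0) h N = P (real N * h) + \<kappa> * (real N * h) * h ^ q"
  shows "\<not> convergence_order_ge \<tau> T (theta_method \<tau> \<theta> :: 'v::euclidean_space dde_method) (q + 1)"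
proof
  assume order: "convergence_order_ge \<tau> T (theta_method \<tau> \<theta> :: 'v dde_method) (q + 1)"
  obtain e :: 'v where "e \<in> Basis" using nonempty_Basis by blast
  then have e: "norm e = 1" "e \<bullet> e = 1" by (auto simp: inner_Basis)
  define f where "f = cut_rhs (c 0) e"
  \<comment> \<open>The value 0 for t \<le> 0 matches the zero history and makes every delayed value
    a nonnegative multiple of \<open>e\<close>.\<close>
  define y where "y t = (if t \<le> 0 then 0 else P t) *\<^sub>R e" for t
  have y_eq: "y t = P t *\<^sub>R e" if "0 \<le> t" for t
    using that P(1) by (cases "t = 0") (auto simp: y_def)
  have f_eq: "f t x (r *\<^sub>R e) = c 0 t *\<^sub>R e" if "0 \<le> r" for t x r
    using that by (simp add: f_def cut_rhs_def e sin4_cut_nonneg_arg)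
  have "dde_solution \<tau> T f (\<lambda>_. 0) y"
    unfolding dde_solution_def
  proof (intro conjI ballI)
    fix t assume t: "t \<in> {0..T}"
    have "(P has_vector_derivative c 0 t) (at t within {0..T})"
      using P(2) has_real_derivative_iff_has_vector_derivative has_vector_derivative_at_within by blast
    then have "((\<lambda>t. P t *\<^sub>R e) has_vector_derivative c 0 t *\<^sub>R e) (at t within {0..T})"
      by (auto intro!: derivative_eq_intros simp: has_real_derivative_iff_has_vector_derivative)
    then have "(y has_vector_derivative c 0 t *\<^sub>R e) (at t within {0..T})"
      by (rule has_vector_derivative_transform[rotated 2]) (use t y_eq in auto)
    moreover have "f t (y t) (y (t - \<tau>)) = c 0 t *\<^sub>R e"
      unfolding y_def[of "t - \<tau>"] using P(3) by (intro f_eq) auto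
    ultimately show "(y has_vector_derivative f t (y t) (y (t - \<tau>))) (at t within {0..T})" by simp
  qed (simp add: y_def)
  moreover have "admissible_rhs T f"
    unfolding f_def by (rule cut_rhs_admissible[where c = c, OF pos(2) c e(1)])
  moreover have "Ck_on (q + 1) (dde_domain T) (\<lambda>(t, x, u). f t x u)"
    unfolding f_def by (rule cut_rhs_Ck_on[where c = c, OF c]) (use q in simp)
  ultimately have "\<exists>C>0. \<exists>h0>0. \<forall>h m N Y.
      uniform_grid \<tau> T h m N \<and> h \<le> h0 \<and> theta_method \<tau> \<theta> f (\<lambda>_. 0) h m N Y \<longrightarrow>
      (\<forall>n\<le>N. norm (Y n - y (real n * h)) \<le> C * h ^ (q + 1))"
    by (intro order[unfolded convergence_order_ge_def, rule_format] conjI Ck_on_const)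
  then obtain C h0 where C: "C > 0" "h0 > 0" and conv: "\<And>h m N Y n.
      uniform_grid \<tau> T h m N \<Longrightarrow> h \<le> h0 \<Longrightarrow> theta_method \<tau> \<theta> f (\<lambda>_. 0) h m N Y \<Longrightarrow> n \<le> N \<Longrightarrow>
      norm (Y n - y (real n * h)) \<le> C * h ^ (q + 1)"
    by blast
  have lower: "\<bar>\<kappa>\<bar> * T \<le> C * h" if g: "uniform_grid \<tau> T h m N" and "h \<le> h0" for h m N
  proof -
    have h: "0 < h" "T = real N * h" using g by (auto simp: uniform_grid_def)
    define Y where "Y n = theta_sum \<theta> (c 0) h n *\<^sub>R e" for n
    have sum_nonneg: "0 \<le> theta_sum \<theta> (c 0) h n" for n
      unfolding theta_sum_def using h \<theta> c_nonneg by (intro sum_nonneg add_nonneg_nonneg mult_nonneg_nonneg) auto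
    \<comment> \<open>The computed delayed values, too, are nonnegative multiples of
      \<open>e\<close> (r = 0 for the history), so the cut-off term is 0 along the method.\<close>
    have delay: "\<exists>r\<ge>0. delay_approx \<tau> (\<lambda>_. 0) h m Y n = r *\<^sub>R e" for n
      using sum_nonneg by (auto simp: delay_approx_def Y_def intro: exI[of _ 0])
    have "theta_method \<tau> \<theta> f (\<lambda>_. 0) h m N Y"
      unfolding theta_method_def
    proof (intro conjI allI impI)
      show "Y 0 = 0" by (simp add: Y_def theta_sum_def)
      fix n
      have "f t x (delay_approx \<tau> (\<lambda>_. 0) h m Y j) = c 0 t *\<^sub>R e" for t x j
        using delay[of j] f_eq by auto
      then show "Y (n + 1) = theta_step \<theta> f h (delay_approx \<tau> (\<lambda>_. 0) h m Y) n (Y n)"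
        unfolding Y_def[of n] by (subst theta_step_quadrature) (auto simp: Y_def theta_sum_def)
    qed
    from conv[OF g that(2) this order_refl]
    have "norm (Y N - y T) \<le> C * h ^ (q + 1)" by (simp add: h)
    moreover have "Y N - y T = (\<kappa> * T * h ^ q) *\<^sub>R e"
      using pos err[of h N] by (simp add: Y_def y_eq h(2) scaleR_add_left)
    ultimately have "(\<bar>\<kappa>\<bar> * T) * h ^ q \<le> (C * h) * h ^ q"
      using e pos h by (simp add: abs_mult ac_simps)
    then show ?thesis using h by simp
  qed
  obtain h m N where g: "uniform_grid \<tau> T h m N" using grid by blast
  then have h: "0 < h" by (simp add: uniform_grid_def)
  have \<kappa>T: "0 < \<bar>\<kappa>\<bar> * T" using \<kappa> pos by simp
  \<comment> \<open>Each cell is split into \<open>k\<close> cells: \<open>k\<close> above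
    \<open>h / h0\<close> makes the step size small enough, and \<open>k\<close> above the second
    bound contradicts \<open>lower\<close>.\<close>
  obtain k :: nat where k: "max (h / h0) (C * h / (\<bar>\<kappa>\<bar> * T)) < real k"
    using reals_Archimedean2 by blast
  have k0: "0 < real k"
    using k h C by (smt (verit) divide_pos_pos max_less_iff_conj)
  have "uniform_grid \<tau> T (h / real k) (k * m) (k * N)"
    using g k0 by (auto simp: uniform_grid_def)
  moreover have "h / real k \<le> h0" using k k0 C by (simp add: field_simps)
  ultimately have "\<bar>\<kappa>\<bar> * T \<le> C * (h / real k)" by (rule lower)
  then have "real k * (\<bar>\<kappa>\<bar> * T) \<le> C * h" using k0 by (simp add: field_simps)
  moreover have "C * h < real k * (\<bar>\<kappa>\<bar> * T)"
    using k \<kappa>T by (simp add: pos_divide_less_eq)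
  ultimately show False by simp
qed

text \<open>For y' = 2 t every cell contributes the same error (2 \<theta> - 1) h^2, in total (2
  \<theta> - 1) T h.\<close>

lemma theta_method_not_convergence_order_ge_2:
  assumes pos: "0 < \<tau>" "0 < T" and grid: "\<exists>h m N. uniform_grid \<tau> T h m N"
    and \<theta>: "0 \<le> \<theta>" "\<theta> \<le> 1" "\<theta> \<noteq> 1/2"
  shows "\<not> convergence_order_ge \<tau> T (theta_method \<tau> \<theta> :: 'v::euclidean_space dde_method) 2"
proof -
  define c :: "nat \<Rightarrow> real \<Rightarrow> real" where
    "c i t = (if i = 0 then 2 * t else if i = 1 then 2 else 0)" for i t
  have "\<not> convergence_order_ge \<tau> T (theta_method \<tau> \<theta> :: 'v dde_method) (1 + 1)"
  proof (rule theta_method_not_convergence_order_ge[OF pos grid \<theta>(1,2),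
        where c = c and P = "\<lambda>t. t\<^sup>2" and \<kappa> = "2 * \<theta> - 1"])
    show "(c i has_real_derivative c (Suc i) s) (at s)" for i s
      by (cases "i = 0"; cases "i = 1") (auto simp: c_def[abs_def] intro!: derivative_eq_intros)
    show "theta_sum \<theta> (c 0) h n = (real n * h)\<^sup>2 + (2 * \<theta> - 1) * (real n * h) * h ^ 1" for h n
      by (induction n) (auto simp: theta_sum_def c_def power2_eq_square algebra_simps)
    show "((\<lambda>t. t\<^sup>2) has_real_derivative c 0 t) (at t)" for t
      by (auto simp: c_def intro!: derivative_eq_intros)
  qed (use \<theta> in \<open>auto simp: c_def\<close>)
  then show ?thesis by (simp add: numeral_2_eq_2)
qed

text \<open>The trapezoidal rule is exact for linear integrands, so a quadratic one is used: for y'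
  = 3 t^2 every cell errs by h^3 / 2, in total T h^2 / 2.\<close>

lemma theta_method_half_not_convergence_order_ge_3:
  assumes pos: "0 < \<tau>" "0 < T" and grid: "\<exists>h m N. uniform_grid \<tau> T h m N"
  shows "\<not> convergence_order_ge \<tau> T (theta_method \<tau> (1/2) :: 'v::euclidean_space dde_method) 3"
proof -
  define c :: "nat \<Rightarrow> real \<Rightarrow> real" where
    "c i t = (if i = 0 then 3 * t\<^sup>2 else if i = 1 then 6 * t else if i = 2 then 6 else 0)" for i t
  have "\<not> convergence_order_ge \<tau> T (theta_method \<tau> (1/2) :: 'v dde_method) (2 + 1)"
  proof (rule theta_method_not_convergence_order_ge[OF pos grid,
        where c = c and P = "\<lambda>t. t ^ 3" and \<kappa> = "1/2"])
    show "(c i has_real_derivative c (Suc i) s) (at s)" for i s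
    proof -
      consider "i = 0" | "i = 1" | "i = 2" | "i > 2" by linarith
      then show ?thesis
        by cases (auto simp: c_def[abs_def] intro!: derivative_eq_intros)
    qed
    show "theta_sum (1/2) (c 0) h n = (real n * h) ^ 3 + 1/2 * (real n * h) * h ^ 2" for h n
      by (induction n) (auto simp: theta_sum_def c_def power2_eq_square power3_eq_cube algebra_simps)
    show "((\<lambda>t. t ^ 3) has_real_derivative c 0 t) (at t)" for t
      by (auto simp: c_def intro!: derivative_eq_intros)
  qed (auto simp: c_def)
  then show ?thesis by simp
qed

section \<open>The exact order of convergence for each \<theta> in [0,1]\<close>

theorem theorem4p1:
  fixes \<tau> T \<theta> :: real
  assumes "\<tau> > 0" and "T > 0"
    and "\<exists>h m N. uniform_grid \<tau> T h m N"
    and "0 \<le> \<theta>" and "\<theta> \<le> 1"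
  shows "(\<theta> = 1/2 \<longrightarrow>
           has_convergence_order \<tau> T (theta_method \<tau> \<theta> :: (real ^ 'd) dde_method) 2) \<and>
         (\<theta> \<noteq> 1/2 \<longrightarrow>
           has_convergence_order \<tau> T (theta_method \<tau> \<theta> :: (real ^ 'd) dde_method) 1)"
proof (intro conjI impI)
  assume "\<theta> = 1/2"
  then show "has_convergence_order \<tau> T (theta_method \<tau> \<theta> :: (real ^ 'd) dde_method) 2"
    using theta_method_half_convergence_order_ge_2[OF assms(1,2)]
      theta_method_half_not_convergence_order_ge_3[OF assms(1-3)]
    unfolding has_convergence_order_def \<open>\<theta> = 1/2\<close> by simp
next
  assume "\<theta> \<noteq> 1/2"
  then have "\<not> convergence_order_ge \<tau> T (theta_method \<tau> \<theta> :: (real ^ 'd) dde_method) (1 + 1)"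
    using theta_method_not_convergence_order_ge_2[OF assms] by (simp add: numeral_2_eq_2)
  then show "has_convergence_order \<tau> T (theta_method \<tau> \<theta> :: (real ^ 'd) dde_method) 1"
    using theta_method_convergence_order_ge_1[OF assms(1,2,4,5)]
    unfolding has_convergence_order_def by blast
qed

end
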